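(* Let $\Phi=B_n$ or $\Phi=D_n$, and fix any $\mathbf s\in{\rm Score}(\Phi)$. Then lazy simple random walk on the Coxeter interchange graph ${\rm IntGr}(\Phi,\mathbf s)$ is rapidly mixing, with mixing time $t_{\rm mix}=O(d\log n)$, where $d$ is the degree of ${\rm IntGr}(\Phi,\mathbf s)$ and the implied constant does not depend on $n$ or $\mathbf s$.
   Context: Vectors: $\mathbf e^{\pm}_{ij}=\mathbf e_i\pm\mathbf e_j$ ($i>j$), $\mathbf e^h_i=\mathbf e_i$ for negative edges $e^-_{ij}$, positive edges $e^+_{ij}$, half edges $e^h_i$. $\mathcal K_{D_n}$ is the signed graph on $[n]$ with all negative and positive edges (one of each per pair); $\mathcal K_{B_n}$ additionally has all half edges. A Coxeter tournament on $\mathcal K_\Phi$ is $(w_e)$, $w_e\in\{0,1\}$, over its edges (games); score $\sum_e(w_e-\frac12)\mathbf e$; a sub-tournament is neutral if this sum over its games is $\mathbf 0$; $\mathcal T*\mathcal X$ flips outcomes of the games of $\mathcal X$. ${\rm Score}(\Phi)$ = set of score sequences of tournaments on $\mathcal K_\Phi$. A copy of a type-$\Phi$ generator is a neutral sub-tournament whose games are: three negative edges pairwise joining three distinct vertices, or one negative and two positive edges pairwise joining three distinct vertices; or (only for $B_n$) a negative or positive edge between $i\ne j$ plus $e^h_i,e^h_j$. ${\rm IntGr}(\Phi,\mathbf s)$ is the graph on tournaments on $\mathcal K_\Phi$ with score $\mathbf s$, with $\mathcal T_1,\mathcal T_2$ adjacent iff $\mathcal T_2=\mathcal T_1*\mathcal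 G$ for a generator copy $\mathcal G\subseteq\mathcal T_1$. It is known to be regular; $d$ is its common degree. Lazy simple random walk: at each step stay put with probability $1/2$, otherwise move to a uniformly random neighbour. Mixing time $t_{\rm mix}=\min\{t:\max_x\frac12\sum_y|P^t(x,y)-\pi(y)|\le1/4\}$, $\pi$ the stationary distribution. *)

theory Defs
  imports "HOL-Probability.Probability"
begin

datatype coxeter_type = Type_B nat | Type_D nat

(* Neg i j and Pos i j are edges of the complete signed graphs only for i > j. *)
datatype edge = Neg nat nat | Pos nat nat | Half nat

fun cox_rank :: "coxeter_type \<Rightarrow> nat" where
  "cox_rank (Type_B n) = n"
| "cox_rank (Type_D n) = n"

definition signed_pairs :: "nat \<Rightarrow> edge set" where
  "signed_pairs n =
     {Neg i j | i j. i \<in> {1..n} \<and> j \<in> {1..n} \<and> i > j} \<union>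
     {Pos i j | i j. i \<in> {1..n} \<and> j \<in> {1..n} \<and> i > j}"

fun edges :: "coxeter_type \<Rightarrow> edge set" where
  "edges (Type_B n) = signed_pairs n \<union> {Half i | i. i \<in> {1..n}}"
| "edges (Type_D n) = signed_pairs n"

(* Vectors of R^n are functions nat => real vanishing outside {1..n}. *)
definition unit_vec :: "nat \<Rightarrow> nat \<Rightarrow> real" where
  "unit_vec i = (\<lambda>k. if k = i then 1 else 0)"

fun edge_vec :: "edge \<Rightarrow> nat \<Rightarrow> real" where
  "edge_vec (Neg i j) = (\<lambda>k. unit_vec i k - unit_vec j k)"
| "edge_vec (Pos i j) = (\<lambda>k. unit_vec i k + unit_vec j k)"
| "edge_vec (Half i) = unit_vec i"

type_synonym tournament = "edge \<Rightarrow> nat"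

definition tournaments :: "coxeter_type \<Rightarrow> tournament set" where
  "tournaments \<Phi> = edges \<Phi> \<rightarrow>\<^sub>E {0, 1}"

definition score_on :: "edge set \<Rightarrow> tournament \<Rightarrow> nat \<Rightarrow> real" where
  "score_on X w = (\<lambda>k. \<Sum>e\<in>X. (real (w e) - 1 / 2) * edge_vec e k)"

definition score :: "coxeter_type \<Rightarrow> tournament \<Rightarrow> nat \<Rightarrow> real" where
  "score \<Phi> w = score_on (edges \<Phi>) w"

definition Score :: "coxeter_type \<Rightarrow> (nat \<Rightarrow> real) set" where
  "Score \<Phi> = score \<Phi> ` tournaments \<Phi>"

(* A sub-tournament of w is given by its set X of games, played with the outcomes of w. *)
definition neutral :: "tournament \<Rightarrow> edge set \<Rightarrow> bool" where
  "neutral w X \<longleftrightarrow> score_on X w = (\<lambda>_. 0)"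

definition flip :: "tournament \<Rightarrow> edge set \<Rightarrow> tournament" where
  "flip w X = (\<lambda>e. if e \<in> X then 1 - w e else w e)"

definition neg_edge :: "nat \<Rightarrow> nat \<Rightarrow> edge" where
  "neg_edge i j = Neg (max i j) (min i j)"

definition pos_edge :: "nat \<Rightarrow> nat \<Rightarrow> edge" where
  "pos_edge i j = Pos (max i j) (min i j)"

inductive generator_games :: "coxeter_type \<Rightarrow> edge set \<Rightarrow> bool" for \<Phi> where
  neg_triangle:
    "\<lbrakk>i \<in> {1..cox_rank \<Phi>}; j \<in> {1..cox_rank \<Phi>}; k \<in> {1..cox_rank \<Phi>}; i \<noteq> j; j \<noteq> k; i \<noteq> k\<rbrakk> \<Longrightarrow>
     generator_games \<Phi> {neg_edge i j, neg_edge j k, neg_edge i k}"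
| mixed_triangle:
    "\<lbrakk>i \<in> {1..cox_rank \<Phi>}; j \<in> {1..cox_rank \<Phi>}; k \<in> {1..cox_rank \<Phi>}; i \<noteq> j; j \<noteq> k; i \<noteq> k\<rbrakk> \<Longrightarrow>
     generator_games \<Phi> {neg_edge i j, pos_edge j k, pos_edge i k}"
| neg_half:
    "\<lbrakk>\<Phi> = Type_B n; i \<in> {1..n}; j \<in> {1..n}; i \<noteq> j\<rbrakk> \<Longrightarrow>
     generator_games \<Phi> {neg_edge i j, Half i, Half j}"
| pos_half:
    "\<lbrakk>\<Phi> = Type_B n; i \<in> {1..n}; j \<in> {1..n}; i \<noteq> j\<rbrakk> \<Longrightarrow>
     generator_games \<Phi> {pos_edge i j, Half i, Half j}"

definition generator_copy :: "coxeter_type \<Rightarrow> tournament \<Rightarrow> edge set \<Rightarrow> bool" where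
  "generator_copy \<Phi> w X \<longleftrightarrow> generator_games \<Phi> X \<and> neutral w X"

definition IntGr_verts :: "coxeter_type \<Rightarrow> (nat \<Rightarrow> real) \<Rightarrow> tournament set" where
  "IntGr_verts \<Phi> s = {w \<in> tournaments \<Phi>. score \<Phi> w = s}"

definition IntGr_adj :: "coxeter_type \<Rightarrow> tournament \<Rightarrow> tournament \<Rightarrow> bool" where
  "IntGr_adj \<Phi> w w' \<longleftrightarrow> (\<exists>X. generator_copy \<Phi> w X \<and> w' = flip w X)"

text \<open>A graph is given by its vertex set \<open>V\<close> and its adjacency relation \<open>adj\<close>.\<close>

definition nbrs :: "'a set \<Rightarrow> ('a \<Rightarrow> 'a \<Rightarrow> bool) \<Rightarrow> 'a \<Rightarrow> 'a set" where
  "nbrs V adj x = {y \<in> V. adj x y}"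

definition regular_degree :: "'a set \<Rightarrow> ('a \<Rightarrow> 'a \<Rightarrow> bool) \<Rightarrow> nat" where
  "regular_degree V adj = (THE d. \<forall>x\<in>V. card (nbrs V adj x) = d)"

(* At an isolated vertex, where there is no neighbour to move to, the walk stays put. *)
definition lazy_step :: "'a set \<Rightarrow> ('a \<Rightarrow> 'a \<Rightarrow> bool) \<Rightarrow> 'a \<Rightarrow> 'a pmf" where
  "lazy_step V adj x =
     (if nbrs V adj x = {} then return_pmf x
      else bind_pmf (bernoulli_pmf (1 / 2))
             (\<lambda>stay. if stay then return_pmf x else pmf_of_set (nbrs V adj x)))"

primrec step_dist :: "('a \<Rightarrow> 'a pmf) \<Rightarrow> nat \<Rightarrow> 'a \<Rightarrow> 'a pmf" where
  "step_dist P 0 x = return_pmf x"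
| "step_dist P (Suc t) x = bind_pmf (step_dist P t x) P"

definition stationary :: "'a set \<Rightarrow> ('a \<Rightarrow> 'a pmf) \<Rightarrow> 'a pmf" where
  "stationary V P = (THE \<pi>. set_pmf \<pi> \<subseteq> V \<and> bind_pmf \<pi> P = \<pi>)"

definition mixing_distance :: "'a set \<Rightarrow> ('a \<Rightarrow> 'a pmf) \<Rightarrow> nat \<Rightarrow> real" where
  "mixing_distance V P t =
     (MAX x\<in>V. 1 / 2 * (\<Sum>y\<in>V. \<bar>pmf (step_dist P t x) y - pmf (stationary V P) y\<bar>))"

(* The value is infinity, rather than an arbitrary number, if the threshold is never reached. *)
definition mixing_time :: "'a set \<Rightarrow> ('a \<Rightarrow> 'a pmf) \<Rightarrow> enat" where
  "mixing_time V P = (INF t \<in> {t. mixing_distance V P t \<le> 1 / 4}. enat t)"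

definition IntGr_degree :: "coxeter_type \<Rightarrow> (nat \<Rightarrow> real) \<Rightarrow> nat" where
  "IntGr_degree \<Phi> s = regular_degree (IntGr_verts \<Phi> s) (IntGr_adj \<Phi>)"

definition IntGr_tmix :: "coxeter_type \<Rightarrow> (nat \<Rightarrow> real) \<Rightarrow> enat" where
  "IntGr_tmix \<Phi> s =
     mixing_time (IntGr_verts \<Phi> s) (lazy_step (IntGr_verts \<Phi> s) (IntGr_adj \<Phi>))"

end

theory Submission
  imports Defs
begin

text \<open>
  A Coxeter tournament lifts to an antisymmetric relation on the signed players \<open>\<plusminus>1, \<dots>, \<plusminus>n\<close>
  (and \<open>0\<close> in type \<open>B\<close>) that is invariant under \<open>(a, b) \<mapsto> (- b, - a)\<close>; the generator copies are
  exactly its directed 3-cycles, up to negation.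

  Let \<open>y = x * D\<close> be adjacent to \<open>x\<close>. The generators meeting \<open>D\<close> but different from it fall into
  triples which, together with \<open>D\<close>, behave like the four triangles of a \<open>K\<^sub>4\<close>: each game lies in
  exactly two of the four. In each triple either no triangle is neutral, or exactly one \<open>X\<close> is
  neutral in \<open>x\<close> and exactly one \<open>Y\<close> in \<open>y\<close>, and then \<open>x * X\<close> and \<open>y * Y\<close> differ by the third triangle.
  Hence the neighbours of \<open>x\<close> and \<open>y\<close> are matched so that \<open>y\<close> is matched with \<open>x\<close> and all other
  matched pairs are adjacent. This gives regularity and shows that one step of the lazy walk
  contracts Lipschitz constants by the factor \<open>1 - 1/d\<close>.

  Two tournaments with the same score differ in a balanced set of arcs. If no triangle flip in
  either tournament decreased their difference, this set would be transitive up to opposite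
  players, which contradicts balance at a player of maximal out-degree. So the diameter is at
  most the number \<open>n\<^sup>2\<close> of games, and the mixing time is at most \<open>d ln (4 n\<^sup>2)\<close> up to rounding.
\<close>

section \<open>Signed players and their games\<close>

text \<open>
  Player \<open>- i\<close> is the negative of player \<open>i\<close>, and \<open>0\<close> is the opponent in the half edge games. The
  vector of \<open>game a b\<close> is \<open>\<plusminus>(e\<^sub>a - e\<^sub>b)\<close> with \<open>e\<^sub>-\<^sub>a = - e\<^sub>a\<close> and \<open>e\<^sub>0 = 0\<close>; the conditional in
  \<open>beats\<close> is this sign. Only \<open>game a b\<close> with \<open>\<bar>a\<bar> \<noteq> \<bar>b\<bar>\<close> is meaningful.
\<close>

fun players :: "coxeter_type \<Rightarrow> int set" where
  "players (Type_B n) = {- int n..int n}"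
| "players (Type_D n) = {- int n..int n} - {0}"

definition game :: "int \<Rightarrow> int \<Rightarrow> edge" where
  "game a b =
     (let M = nat (max \<bar>a\<bar> \<bar>b\<bar>); m = nat (min \<bar>a\<bar> \<bar>b\<bar>)
      in if m = 0 then Half M else if 0 < a \<longleftrightarrow> 0 < b then Neg M m else Pos M m)"

definition beats :: "tournament \<Rightarrow> int \<Rightarrow> int \<Rightarrow> bool" where
  "beats w a b \<longleftrightarrow> (w (game a b) = 1 \<longleftrightarrow> (if \<bar>b\<bar> < \<bar>a\<bar> then 0 < a else b < 0))"

definition trigon :: "int \<Rightarrow> int \<Rightarrow> int \<Rightarrow> edge set" where
  "trigon a b c = {game a b, game b c, game c a}"

definition player_vec :: "int \<Rightarrow> nat \<Rightarrow> real" where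
  "player_vec a k = (if k = nat \<bar>a\<bar> then real_of_int (sgn a) else 0)"

lemma game_commute: "game b a = game a b"
  by (auto simp: game_def Let_def max.commute min.commute)

lemma game_uminus: "game (- a) (- b) = game a b"
  by (auto simp: game_def Let_def min_def split: if_splits)

lemma game_of_less: "\<bar>b\<bar> < \<bar>a\<bar> \<Longrightarrow> game a b =
   (if b = 0 then Half (nat \<bar>a\<bar>) else if 0 < a \<longleftrightarrow> 0 < b then Neg (nat \<bar>a\<bar>) (nat \<bar>b\<bar>) else Pos (nat \<bar>a\<bar>) (nat \<bar>b\<bar>))"
  by (simp add: game_def Let_def)

text \<open>With the larger absolute value listed first, an edge records both absolute values and,
  unless the smaller player is \<open>0\<close>, whether the signs agree. This leaves only the swap
  and the simultaneous negation.\<close>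

lemma game_eq_iff:
  assumes "\<bar>a\<bar> \<noteq> \<bar>b\<bar>" "\<bar>c\<bar> \<noteq> \<bar>d\<bar>"
  shows "game a b = game c d \<longleftrightarrow>
    (a = c \<and> b = d) \<or> (a = d \<and> b = c) \<or> (a = - c \<and> b = - d) \<or> (a = - d \<and> b = - c)"
    (is "?l \<longleftrightarrow> ?r")
proof
  assume l: ?l
  have *: "(a = c \<and> b = d) \<or> (a = - c \<and> b = - d)"
    if "\<bar>b\<bar> < \<bar>a\<bar>" "\<bar>d\<bar> < \<bar>c\<bar>" "game a b = game c d" for a b c d
  proof -
    have "\<bar>a\<bar> = \<bar>c\<bar> \<and> \<bar>b\<bar> = \<bar>d\<bar> \<and> (b = 0 \<or> ((0 < a) = (0 < b)) = ((0 < c) = (0 < d)))"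
      using that(3) unfolding game_of_less[OF that(1)] game_of_less[OF that(2)]
      by (auto split: if_splits)
    then show ?thesis using that(1,2) by linarith
  qed
  consider "\<bar>b\<bar> < \<bar>a\<bar>" "\<bar>d\<bar> < \<bar>c\<bar>" | "\<bar>b\<bar> < \<bar>a\<bar>" "\<bar>c\<bar> < \<bar>d\<bar>"
    | "\<bar>a\<bar> < \<bar>b\<bar>" "\<bar>d\<bar> < \<bar>c\<bar>" | "\<bar>a\<bar> < \<bar>b\<bar>" "\<bar>c\<bar> < \<bar>d\<bar>"
    using assms by linarith
  then show ?r
    using l *[of b a d c] *[of b a c d] *[of a b c d] *[of a b d c] game_commute by cases metis+
next
  assume ?r
  then show ?l using game_commute game_uminus by metis
qed

lemma beats_commute:
  assumes "\<bar>a\<bar> \<noteq> \<bar>b\<bar>"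
  shows "beats w b a \<longleftrightarrow> \<not> beats w a b"
  using assms unfolding beats_def game_commute[of b a] by auto

lemma beats_uminus:
  assumes "\<bar>a\<bar> \<noteq> \<bar>b\<bar>"
  shows "beats w (- b) (- a) \<longleftrightarrow> beats w a b"
  using assms unfolding beats_def game_uminus game_commute[of b a] by auto

lemma beats_flip:
  assumes "w (game a b) \<in> {0, 1}"
  shows "beats (flip w X) a b \<longleftrightarrow> (beats w a b \<noteq> (game a b \<in> X))"
  using assms unfolding beats_def flip_def by auto

lemma players_uminus [simp]: "- a \<in> players \<Phi> \<longleftrightarrow> a \<in> players \<Phi>"
  by (cases \<Phi>) auto

lemma finite_players [simp]: "finite (players \<Phi>)"
  by (cases \<Phi>) auto

section \<open>Edges and generators in terms of signed players\<close>

lemma neg_edge_eq_game: "0 < i \<Longrightarrow> 0 < j \<Longrightarrow> neg_edge i j = game (int i) (int j)"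
  by (auto simp: neg_edge_def game_def Let_def max_def min_def)

lemma pos_edge_eq_game: "0 < i \<Longrightarrow> 0 < j \<Longrightarrow> pos_edge i j = game (int i) (- int j)"
  by (auto simp: pos_edge_def game_def Let_def max_def min_def)

lemma Half_eq_game: "Half i = game (int i) 0"
  by (auto simp: game_def)

lemma game_eq_neg_edge: "a \<noteq> 0 \<Longrightarrow> b \<noteq> 0 \<Longrightarrow> (0 < a \<longleftrightarrow> 0 < b) \<Longrightarrow> game a b = neg_edge (nat \<bar>a\<bar>) (nat \<bar>b\<bar>)"
  by (auto simp: neg_edge_def game_def Let_def max_def min_def)

lemma game_eq_pos_edge: "a \<noteq> 0 \<Longrightarrow> b \<noteq> 0 \<Longrightarrow> (0 < a \<longleftrightarrow> \<not> 0 < b) \<Longrightarrow> game a b = pos_edge (nat \<bar>a\<bar>) (nat \<bar>b\<bar>)"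
  by (auto simp: pos_edge_def game_def Let_def max_def min_def)

lemma game_eq_Half: "game a 0 = Half (nat \<bar>a\<bar>)" "game 0 a = Half (nat \<bar>a\<bar>)"
  by (auto simp: game_def)

lemma edges_eq: "edges \<Phi> = {game a b | a b. a \<in> players \<Phi> \<and> b \<in> players \<Phi> \<and> \<bar>a\<bar> \<noteq> \<bar>b\<bar>}"
proof (intro equalityI subsetI)
  fix e assume e: "e \<in> edges \<Phi>"
  show "e \<in> {game a b | a b. a \<in> players \<Phi> \<and> b \<in> players \<Phi> \<and> \<bar>a\<bar> \<noteq> \<bar>b\<bar>}"
  proof (cases e)
    case (Neg i j)
    with e have "e = game (int i) (int j)" "int i \<in> players \<Phi>" "int j \<in> players \<Phi>" "\<bar>int i\<bar> \<noteq> \<bar>int j\<bar>"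
      by (cases \<Phi>; auto simp: signed_pairs_def game_def)+
    then show ?thesis by blast
  next
    case (Pos i j)
    with e have "e = game (int i) (- int j)" "int i \<in> players \<Phi>" "- int j \<in> players \<Phi>" "\<bar>int i\<bar> \<noteq> \<bar>- int j\<bar>"
      by (cases \<Phi>; auto simp: signed_pairs_def game_def)+
    then show ?thesis by blast
  next
    case (Half i)
    with e have "e = game (int i) 0" "int i \<in> players \<Phi>" "0 \<in> players \<Phi>" "\<bar>int i\<bar> \<noteq> \<bar>0\<bar>"
      by (cases \<Phi>; auto simp: signed_pairs_def game_def)+
    then show ?thesis by blast
  qed
next
  fix e assume "e \<in> {game a b | a b. a \<in> players \<Phi> \<and> b \<in> players \<Phi> \<and> \<bar>a\<bar> \<noteq> \<bar>b\<bar>}"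
  then show "e \<in> edges \<Phi>"
    by (cases \<Phi>) (auto simp: game_def Let_def signed_pairs_def max_def min_def split: if_splits)
qed

lemma game_in_edges [intro]:
  "a \<in> players \<Phi> \<Longrightarrow> b \<in> players \<Phi> \<Longrightarrow> \<bar>a\<bar> \<noteq> \<bar>b\<bar> \<Longrightarrow> game a b \<in> edges \<Phi>"
  unfolding edges_eq by blast

lemma finite_edges [simp]: "finite (edges \<Phi>)"
proof -
  have "edges \<Phi> \<subseteq> (\<lambda>(a, b). game a b) ` (players \<Phi> \<times> players \<Phi>)"
    unfolding edges_eq by auto
  then show ?thesis by (rule finite_subset) auto
qed

lemma trigon_rotate: "trigon b c a = trigon a b c"
  by (auto simp: trigon_def)

lemma trigon_uminus: "trigon (- a) (- b) (- c) = trigon a b c"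
  by (simp add: trigon_def game_uminus)

text \<open>Opposite players have no game against each other, so it is the absolute values that have
  to differ.\<close>

definition triple :: "coxeter_type \<Rightarrow> int \<Rightarrow> int \<Rightarrow> int \<Rightarrow> bool" where
  "triple \<Phi> a b c \<longleftrightarrow> a \<in> players \<Phi> \<and> b \<in> players \<Phi> \<and> c \<in> players \<Phi> \<and>
     \<bar>a\<bar> \<noteq> \<bar>b\<bar> \<and> \<bar>b\<bar> \<noteq> \<bar>c\<bar> \<and> \<bar>c\<bar> \<noteq> \<bar>a\<bar>"

text \<open>Among three nonzero players the number of pairs with opposite signs is 0 or 2, so a
  triangle has three negative edges, or one negative and two positive ones. A triangle through
  \<open>0\<close> has two half edges and one signed edge.\<close>

lemma generator_games_iff: "generator_games \<Phi> X \<longleftrightarrow> (\<exists>a b c. triple \<Phi> a b c \<and> X = trigon a b c)"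
proof
  assume "generator_games \<Phi> X"
  then show "\<exists>a b c. triple \<Phi> a b c \<and> X = trigon a b c"
  proof cases
    case (neg_triangle i j k)
    then have "triple \<Phi> (int i) (int j) (int k)"
      by (cases \<Phi>) (auto simp: triple_def)
    moreover have "X = trigon (int i) (int j) (int k)"
      using neg_triangle by (simp add: trigon_def neg_edge_eq_game game_commute[of "int k" "int i"])
    ultimately show ?thesis by blast
  next
    case (mixed_triangle i j k)
    then have "triple \<Phi> (int i) (int j) (- int k)"
      by (cases \<Phi>) (auto simp: triple_def)
    moreover have "X = trigon (int i) (int j) (- int k)"
      using mixed_triangle
      by (simp add: trigon_def neg_edge_eq_game pos_edge_eq_game game_commute[of "- int k" "int i"])
    ultimately show ?thesis by blast
  next
    case (neg_half n i j)
    then have "triple \<Phi> (int i) (int j) 0"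
      by (simp add: triple_def)
    moreover have "X = trigon (int i) (int j) 0"
      using neg_half by (simp add: trigon_def neg_edge_eq_game Half_eq_game game_commute[of 0] insert_commute)
    ultimately show ?thesis by blast
  next
    case (pos_half n i j)
    then have "triple \<Phi> (int i) (- int j) 0"
      by (simp add: triple_def)
    moreover have "X = trigon (int i) (- int j) 0"
      using pos_half game_uminus[of "int j" 0]
      by (simp add: trigon_def pos_edge_eq_game Half_eq_game game_commute[of 0] insert_commute)
    ultimately show ?thesis by blast
  qed
next
  assume "\<exists>a b c. triple \<Phi> a b c \<and> X = trigon a b c"
  then obtain a b c where t: "triple \<Phi> a b c" and X: "X = trigon a b c" by blast
  define i j k where "i = nat \<bar>a\<bar>" and "j = nat \<bar>b\<bar>" and "k = nat \<bar>c\<bar>"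
  note ijk = i_def j_def k_def
  have ne: "i \<noteq> j" "j \<noteq> k" "i \<noteq> k" using t by (auto simp: triple_def ijk)
  have gen0: "generator_games \<Phi> (trigon a b 0)" if ab0: "triple \<Phi> a b 0" for a b
  proof -
    \<comment> \<open>\<open>0\<close> is a player only in type \<open>B\<close>.\<close>
    obtain n where n: "\<Phi> = Type_B n" using ab0 by (cases \<Phi>) (auto simp: triple_def)
    let ?i = "nat \<bar>a\<bar>" and ?j = "nat \<bar>b\<bar>"
    have "?i \<in> {1..n}" "?j \<in> {1..n}" "?i \<noteq> ?j" using ab0 n by (auto simp: triple_def)
    then have "generator_games \<Phi> {neg_edge ?i ?j, Half ?i, Half ?j}"
      "generator_games \<Phi> {pos_edge ?i ?j, Half ?i, Half ?j}"
      using n generator_games.neg_half generator_games.pos_half by auto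
    moreover have "trigon a b 0 = {neg_edge ?i ?j, Half ?i, Half ?j} \<or>
        trigon a b 0 = {pos_edge ?i ?j, Half ?i, Half ?j}"
      using game_eq_neg_edge[of a b] game_eq_pos_edge[of a b] ab0
      by (cases "0 < a \<longleftrightarrow> 0 < b") (simp_all add: trigon_def game_eq_Half triple_def insert_commute)
    ultimately show ?thesis by metis
  qed
  show "generator_games \<Phi> X"
  proof (cases "a = 0 \<or> b = 0 \<or> c = 0")
    case True
    then show ?thesis
      using gen0[of a b] gen0[of b c] gen0[of c a] t X trigon_rotate
      unfolding triple_def by metis
  next
    case False
    have r: "i \<in> {1..cox_rank \<Phi>}" "j \<in> {1..cox_rank \<Phi>}" "k \<in> {1..cox_rank \<Phi>}"
      using False t by (cases \<Phi>; auto simp: ijk triple_def)+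
    note gens = generator_games.neg_triangle[OF r(1,2,3)] generator_games.mixed_triangle[OF r(1,2,3)]
      generator_games.mixed_triangle[OF r(2,3,1)] generator_games.mixed_triangle[OF r(3,1,2)]
    have com: "neg_edge p q = neg_edge q p" "pos_edge p q = pos_edge q p" for p q
      by (auto simp: neg_edge_def pos_edge_def max.commute min.commute)
    note N = game_eq_neg_edge[of a b] game_eq_neg_edge[of b c] game_eq_neg_edge[of c a]
    note P = game_eq_pos_edge[of a b] game_eq_pos_edge[of b c] game_eq_pos_edge[of c a]
    \<comment> \<open>In the mixed cases the pair with equal signs carries the negative edge and
      decides which rotation of the mixed triangle applies.\<close>
    consider "0 < a \<longleftrightarrow> 0 < b" "0 < b \<longleftrightarrow> 0 < c" | "0 < a \<longleftrightarrow> 0 < b" "\<not> (0 < b \<longleftrightarrow> 0 < c)"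
      | "\<not> (0 < a \<longleftrightarrow> 0 < b)" "0 < b \<longleftrightarrow> 0 < c" | "\<not> (0 < a \<longleftrightarrow> 0 < b)" "\<not> (0 < b \<longleftrightarrow> 0 < c)"
      by blast
    then show ?thesis
    proof cases
      case 1
      then have "game a b = neg_edge i j" "game b c = neg_edge j k" "game c a = neg_edge k i"
        using False N unfolding ijk by metis+
      then have "X = {neg_edge i j, neg_edge j k, neg_edge i k}"
        unfolding X trigon_def by (metis com(1))
      with gens(1) ne show ?thesis by simp
    next
      case 2
      then have "game a b = neg_edge i j" "game b c = pos_edge j k" "game c a = pos_edge k i"
        using False N P unfolding ijk by metis+
      then have "X = {neg_edge i j, pos_edge j k, pos_edge i k}"
        unfolding X trigon_def by (metis com(2))
      with gens(2) ne show ?thesis by simp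
    next
      case 3
      then have "game a b = pos_edge i j" "game b c = neg_edge j k" "game c a = pos_edge k i"
        using False N P unfolding ijk by metis+
      then have "X = {neg_edge j k, pos_edge k i, pos_edge j i}"
        unfolding X trigon_def by (metis com(2) insert_commute)
      with gens(3) ne show ?thesis by simp
    next
      case 4
      then have "game a b = pos_edge i j" "game b c = pos_edge j k" "game c a = neg_edge k i"
        using False N P unfolding ijk by metis+
      then have "X = {neg_edge k i, pos_edge i j, pos_edge k j}"
        unfolding X trigon_def by (metis com(2) insert_commute)
      with gens(4) ne show ?thesis by simp
    qed
  qed
qed

section \<open>Scores in signed coordinates and neutrality of triangles\<close>

lemma player_vec_other: "\<bar>a\<bar> \<noteq> \<bar>b\<bar> \<Longrightarrow> player_vec b (nat \<bar>a\<bar>) = 0"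
  by (simp add: player_vec_def)

lemma player_vec_self: "player_vec a (nat \<bar>a\<bar>) = real_of_int (sgn a)"
  by (simp add: player_vec_def)

lemma player_vec_pos: "0 < a \<Longrightarrow> player_vec a = unit_vec (nat \<bar>a\<bar>)"
  by (auto simp: player_vec_def unit_vec_def)

lemma player_vec_neg: "a < 0 \<Longrightarrow> player_vec a = (\<lambda>k. - unit_vec (nat \<bar>a\<bar>) k)"
  by (auto simp: player_vec_def unit_vec_def)

lemma player_vec_zero: "player_vec 0 = (\<lambda>k. 0)"
  by (auto simp: player_vec_def)

lemma edge_vec_game:
  assumes "\<bar>b\<bar> < \<bar>a\<bar>"
  shows "edge_vec (game a b) k = (if 0 < a then 1 else - 1) * (player_vec a k - player_vec b k)"
proof -
  have m: "max \<bar>a\<bar> \<bar>b\<bar> = \<bar>a\<bar>" "min \<bar>a\<bar> \<bar>b\<bar> = \<bar>b\<bar>" using assms by auto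
  have "a \<noteq> 0" using assms by auto
  then consider "0 < a" "0 < b" | "0 < a" "b < 0" | "0 < a" "b = 0"
    | "a < 0" "0 < b" | "a < 0" "b < 0" | "a < 0" "b = 0"
    by linarith
  then show ?thesis
    unfolding game_def m Let_def
    by cases (simp_all add: player_vec_pos player_vec_neg player_vec_zero)
qed

text \<open>\<open>beats\<close> absorbs the sign of the edge vector: a game contributes half of the
  winner's vector minus half of the loser's, whatever the order and the signs of the
  players.\<close>

lemma game_term_eq:
  assumes "\<bar>a\<bar> \<noteq> \<bar>b\<bar>" "w (game a b) \<in> {0, 1}"
  shows "(real (w (game a b)) - 1 / 2) * edge_vec (game a b) k =
    (if beats w a b then 1 / 2 else - 1 / 2) * (player_vec a k - player_vec b k)"
proof -
  have *: "(real (w (game a b)) - 1 / 2) * edge_vec (game a b) k =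
    (if beats w a b then 1 / 2 else - 1 / 2) * (player_vec a k - player_vec b k)"
    if "\<bar>b\<bar> < \<bar>a\<bar>" "w (game a b) \<in> {0, 1}" for a b
    using that(2) unfolding edge_vec_game[OF that(1)] beats_def by (auto simp: that(1) algebra_simps)
  show ?thesis
  proof (cases "\<bar>b\<bar> < \<bar>a\<bar>")
    case True
    then show ?thesis using * assms by blast
  next
    case False
    then have ba: "\<bar>a\<bar> < \<bar>b\<bar>" using assms by linarith
    show ?thesis
      using *[OF ba] assms beats_commute[OF assms(1), of w]
      unfolding game_commute[of b a] by (auto simp: algebra_simps)
  qed
qed

lemma trigon_games_distinct:
  assumes "\<bar>a\<bar> \<noteq> \<bar>b\<bar>" "\<bar>b\<bar> \<noteq> \<bar>c\<bar>" "\<bar>c\<bar> \<noteq> \<bar>a\<bar>"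
  shows "game a b \<noteq> game b c" "game b c \<noteq> game c a" "game c a \<noteq> game a b"
  using assms by (auto simp: game_eq_iff)

text \<open>The coordinate of a nonzero vertex involves only its two games in the triangle and
  forces them to be oriented consistently. At most one vertex is \<open>0\<close>, so at least two
  of the three equations are available, and two suffice. Conversely, the sum over a directed cycle
  telescopes.\<close>

lemma neutral_trigon_iff:
  assumes "\<bar>a\<bar> \<noteq> \<bar>b\<bar>" "\<bar>b\<bar> \<noteq> \<bar>c\<bar>" "\<bar>c\<bar> \<noteq> \<bar>a\<bar>"
    and "w (game a b) \<in> {0, 1}" "w (game b c) \<in> {0, 1}" "w (game c a) \<in> {0, 1}"
  shows "neutral w (trigon a b c) \<longleftrightarrow> beats w a b = beats w b c \<and> beats w b c = beats w c a"
proof -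
  let ?h = "\<lambda>p. (if p then 1 / 2 else - 1 / 2) :: real"
  have h_eq: "?h p = ?h q \<longleftrightarrow> p = q" for p q by simp
  have eq: "score_on (trigon a b c) w k =
     ?h (beats w a b) * (player_vec a k - player_vec b k) +
     ?h (beats w b c) * (player_vec b k - player_vec c k) +
     ?h (beats w c a) * (player_vec c k - player_vec a k)" for k
    unfolding game_term_eq[where w = w, OF assms(1,4), symmetric]
      game_term_eq[where w = w, OF assms(2,5), symmetric] game_term_eq[where w = w, OF assms(3,6), symmetric]
    using trigon_games_distinct[OF assms(1-3)] by (auto simp: score_on_def trigon_def)
  show ?thesis
  proof
    assume "neutral w (trigon a b c)"
    then have z: "score_on (trigon a b c) w k = 0" for k by (simp add: neutral_def)
    have ab: "?h (beats w a b) = ?h (beats w c a)" if "a \<noteq> 0"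
      using z[of "nat \<bar>a\<bar>"] that
      unfolding eq player_vec_self player_vec_other[OF assms(1)] player_vec_other[OF assms(3)[symmetric]]
      by (auto simp: sgn_if split: if_splits)
    have bc: "?h (beats w a b) = ?h (beats w b c)" if "b \<noteq> 0"
      using z[of "nat \<bar>b\<bar>"] that
      unfolding eq player_vec_self player_vec_other[OF assms(1)[symmetric]] player_vec_other[OF assms(2)]
      by (auto simp: sgn_if split: if_splits)
    have ca: "?h (beats w b c) = ?h (beats w c a)" if "c \<noteq> 0"
      using z[of "nat \<bar>c\<bar>"] that
      unfolding eq player_vec_self player_vec_other[OF assms(2)[symmetric]] player_vec_other[OF assms(3)]
      by (auto simp: sgn_if split: if_splits)
    show "beats w a b = beats w b c \<and> beats w b c = beats w c a"
      using ab bc ca assms(1-3) unfolding h_eq by (cases "a = 0"; cases "b = 0") auto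
  next
    assume "beats w a b = beats w b c \<and> beats w b c = beats w c a"
    then show "neutral w (trigon a b c)"
      unfolding neutral_def fun_eq_iff eq by (auto simp: algebra_simps)
  qed
qed

section \<open>The interchange graph\<close>

lemma triple_rotate: "triple \<Phi> b c a \<longleftrightarrow> triple \<Phi> a b c"
  by (auto simp: triple_def)

lemma tournament_outcome: "w \<in> tournaments \<Phi> \<Longrightarrow> e \<in> edges \<Phi> \<Longrightarrow> w e \<in> {0, 1}"
  by (auto simp: tournaments_def)

lemma trigon_subset_edges: "triple \<Phi> a b c \<Longrightarrow> trigon a b c \<subseteq> edges \<Phi>"
  by (auto simp: triple_def trigon_def)

lemma generator_games_subset_edges: "generator_games \<Phi> X \<Longrightarrow> X \<subseteq> edges \<Phi>"
  using trigon_subset_edges generator_games_iff by metis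

lemma generator_games_nonempty: "generator_games \<Phi> X \<Longrightarrow> X \<noteq> {}"
  by (auto simp: generator_games_iff trigon_def)

lemma finite_generator_games: "finite {X. generator_games \<Phi> X}"
  by (rule finite_subset[of _ "Pow (edges \<Phi>)"]) (auto dest: generator_games_subset_edges)

lemma finite_generator_copies: "finite {X. generator_copy \<Phi> w X}"
  by (rule finite_subset[OF _ finite_generator_games[of \<Phi>]]) (auto simp: generator_copy_def)

lemma generator_copy_trigon_iff:
  assumes "w \<in> tournaments \<Phi>" "triple \<Phi> a b c"
  shows "generator_copy \<Phi> w (trigon a b c) \<longleftrightarrow>
    beats w a b = beats w b c \<and> beats w b c = beats w c a"
proof -
  have "generator_games \<Phi> (trigon a b c)" using assms(2) generator_games_iff by blast
  moreover have "w (game a b) \<in> {0, 1}" "w (game b c) \<in> {0, 1}" "w (game c a) \<in> {0, 1}"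
    using assms tournament_outcome[OF assms(1)] unfolding triple_def by blast+
  ultimately show ?thesis
    using neutral_trigon_iff assms(2) unfolding generator_copy_def triple_def by blast
qed

section \<open>Flipping games and adjacency\<close>

lemma beats_flip_tournament:
  assumes "w \<in> tournaments \<Phi>" "a \<in> players \<Phi>" "b \<in> players \<Phi>" "\<bar>a\<bar> \<noteq> \<bar>b\<bar>"
  shows "beats (flip w X) a b \<longleftrightarrow> (beats w a b \<noteq> (game a b \<in> X))"
  by (intro beats_flip tournament_outcome[OF assms(1)] game_in_edges assms)

lemma flip_tournament:
  assumes "w \<in> tournaments \<Phi>" "X \<subseteq> edges \<Phi>"
  shows "flip w X \<in> tournaments \<Phi>"
  using assms by (auto simp: tournaments_def flip_def PiE_iff extensional_def)

lemma flip_flip: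
  assumes "w \<in> tournaments \<Phi>" "X \<subseteq> edges \<Phi>"
  shows "flip (flip w X) Y = flip w ((X - Y) \<union> (Y - X))"
proof
  fix e
  have "e \<in> X \<Longrightarrow> w e \<in> {0, 1}" using tournament_outcome assms by blast
  then show "flip (flip w X) Y e = flip w ((X - Y) \<union> (Y - X)) e"
    by (auto simp: flip_def)
qed

lemma flip_eq_iff:
  assumes "w \<in> tournaments \<Phi>" "X \<subseteq> edges \<Phi>" "Y \<subseteq> edges \<Phi>"
  shows "flip w X = flip w Y \<longleftrightarrow> X = Y"
proof
  assume eq: "flip w X = flip w Y"
  have "e \<in> X \<longleftrightarrow> e \<in> Y" for e
  proof (cases "e \<in> edges \<Phi>")
    case True
    then have "w e \<in> {0, 1}" using tournament_outcome assms by blast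
    then show ?thesis using fun_cong[OF eq, of e] by (auto simp: flip_def split: if_splits)
  qed (use assms in blast)
  then show "X = Y" by blast
qed simp

text \<open>A flip negates the centred outcome of each game in \<open>X\<close>. Hence the score
  survives exactly when \<open>X\<close> is neutral.\<close>

lemma score_flip:
  assumes "w \<in> tournaments \<Phi>" "X \<subseteq> edges \<Phi>"
  shows "score \<Phi> (flip w X) k = score \<Phi> w k - 2 * score_on X w k"
proof -
  let ?t = "\<lambda>w e. (real (w e) - 1 / 2) * edge_vec e k"
  have split: "sum f (edges \<Phi>) = sum f (edges \<Phi> - X) + sum f X" for f :: "edge \<Rightarrow> real"
    using sum.subset_diff[OF assms(2) finite_edges] .
  have "sum (?t (flip w X)) (edges \<Phi> - X) = sum (?t w) (edges \<Phi> - X)"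
    by (rule sum.cong) (auto simp: flip_def)
  moreover have "sum (?t (flip w X)) X = sum (\<lambda>e. - ?t w e) X"
  proof (rule sum.cong)
    fix e assume e: "e \<in> X"
    then have "w e \<in> {0, 1}" using tournament_outcome assms by blast
    then show "?t (flip w X) e = - ?t w e" using e by (auto simp: flip_def)
  qed simp
  ultimately show ?thesis
    unfolding score_def score_on_def split by (simp add: sum_negf)
qed

lemma flip_in_verts_iff:
  assumes "w \<in> IntGr_verts \<Phi> s" "X \<subseteq> edges \<Phi>"
  shows "flip w X \<in> IntGr_verts \<Phi> s \<longleftrightarrow> neutral w X"
  using assms flip_tournament[of w \<Phi> X] score_flip[of w \<Phi> X]
  by (auto simp: IntGr_verts_def neutral_def fun_eq_iff)

lemma flip_copy_in_verts:
  "w \<in> IntGr_verts \<Phi> s \<Longrightarrow> generator_copy \<Phi> w X \<Longrightarrow> flip w X \<in> IntGr_verts \<Phi> s"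
  using flip_in_verts_iff generator_games_subset_edges by (auto simp: generator_copy_def)

lemma flip_copy_flip:
  assumes x: "x \<in> IntGr_verts \<Phi> s" and copy: "generator_copy \<Phi> x D"
  shows "flip (flip x D) D = x" and "generator_copy \<Phi> (flip x D) D"
proof -
  have DE: "D \<subseteq> edges \<Phi>" using copy generator_games_subset_edges by (simp add: generator_copy_def)
  have xt: "x \<in> tournaments \<Phi>" using x by (simp add: IntGr_verts_def)
  show flip_back: "flip (flip x D) D = x" unfolding flip_flip[OF xt DE] by (simp add: flip_def)
  show "generator_copy \<Phi> (flip x D) D"
    using flip_in_verts_iff[OF flip_copy_in_verts[OF x copy] DE] flip_back x copy
    by (simp add: generator_copy_def)
qed

text \<open>Equal scores make the flipped set neutral, so adjacency of two vertices can be read off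
  from the set of games on which they differ.\<close>

lemma IntGr_adj_iff:
  assumes "w \<in> IntGr_verts \<Phi> s" "w' \<in> IntGr_verts \<Phi> s"
  shows "IntGr_adj \<Phi> w w' \<longleftrightarrow> (\<exists>X. generator_games \<Phi> X \<and> w' = flip w X)"
  using assms flip_in_verts_iff[OF assms(1)] generator_games_subset_edges
  unfolding IntGr_adj_def generator_copy_def by blast

lemma IntGr_adj_sym:
  assumes "w \<in> IntGr_verts \<Phi> s" "w' \<in> IntGr_verts \<Phi> s"
  shows "IntGr_adj \<Phi> w w' \<longleftrightarrow> IntGr_adj \<Phi> w' w"
  using flip_copy_flip assms unfolding IntGr_adj_def by metis

lemma nbrs_IntGr:
  assumes "w \<in> IntGr_verts \<Phi> s"
  shows "nbrs (IntGr_verts \<Phi> s) (IntGr_adj \<Phi>) w = flip w ` {X. generator_copy \<Phi> w X}"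
  using flip_copy_in_verts[OF assms] by (auto simp: nbrs_def IntGr_adj_def)

text \<open>This allows degrees and sums over neighbours to be computed over generator
  copies.\<close>

lemma inj_on_flip_copies:
  assumes "w \<in> IntGr_verts \<Phi> s"
  shows "inj_on (flip w) {X. generator_copy \<Phi> w X}"
  using assms flip_eq_iff generator_games_subset_edges
  unfolding inj_on_def IntGr_verts_def generator_copy_def by blast

text \<open>Rotation, reversal and global negation bring the given game to the first place; negation
  turns the third vertex \<open>r\<close> into \<open>- r\<close>.\<close>

lemma generator_through_game:
  assumes "generator_games \<Phi> X" "game u v \<in> X" "\<bar>u\<bar> \<noteq> \<bar>v\<bar>"
  shows "\<exists>z. triple \<Phi> u v z \<and> X = trigon u v z"
proof -
  have *: "\<exists>z. triple \<Phi> u v z \<and> X = trigon u v z"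
    if t: "triple \<Phi> p q r" and X: "X = trigon p q r" and g: "game u v = game p q" for p q r
  proof -
    have "\<bar>p\<bar> \<noteq> \<bar>q\<bar>" using t by (simp add: triple_def)
    then consider "u = p" "v = q" | "u = q" "v = p" | "u = - p" "v = - q" | "u = - q" "v = - p"
      using g game_eq_iff[OF assms(3)] by blast
    then show ?thesis
    proof cases
      case 1 then show ?thesis using t X by blast
    next
      case 2 then show ?thesis
        using t X by (intro exI[of _ r]) (auto simp: triple_def trigon_def game_commute)
    next
      case 3 then show ?thesis using t X trigon_uminus[of p q r]
        by (intro exI[of _ "- r"]) (auto simp: triple_def)
    next
      case 4 then show ?thesis using t X
        by (intro exI[of _ "- r"]) (auto simp: triple_def trigon_def game_commute game_uminus)
    qed
  qed
  obtain a b c where t: "triple \<Phi> a b c" and X: "X = trigon a b c"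
    using assms(1) generator_games_iff by blast
  from assms(2) X consider "game u v = game a b" | "game u v = game b c" | "game u v = game c a"
    by (auto simp: trigon_def)
  then show ?thesis
    using *[of a b c] *[of b c a] *[of c a b] t X trigon_rotate triple_rotate by cases metis+
qed

section \<open>Matching the neighbours of adjacent tournaments\<close>

text \<open>The classes in \<open>\<K>\<close> are disjoint and meet \<open>A\<close> and
  \<open>B\<close> either both in nothing or in one element each, so pairing these elements class by
  class gives the bijection.\<close>

lemma bij_from_partition:
  assumes disj: "\<And>K K' X. K \<in> \<K> \<Longrightarrow> K' \<in> \<K> \<Longrightarrow> X \<in> K \<Longrightarrow> X \<in> K' \<Longrightarrow> K = K'"
    and sub: "A \<subseteq> \<Union>\<K>" "B \<subseteq> \<Union>\<K>"
    and pair: "\<And>K. K \<in> \<K> \<Longrightarrow>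
      (K \<inter> A = {} \<and> K \<inter> B = {}) \<or> (\<exists>X Y. K \<inter> A = {X} \<and> K \<inter> B = {Y} \<and> R X Y)"
  shows "\<exists>\<phi>. bij_betw \<phi> A B \<and> (\<forall>X\<in>A. R X (\<phi> X))"
proof -
  define Q where "Q X Y \<longleftrightarrow> (\<exists>K\<in>\<K>. K \<inter> A = {X} \<and> K \<inter> B = {Y} \<and> R X Y)" for X Y
  have Q1: "\<exists>Y. Q X Y" if "X \<in> A" for X
  proof -
    obtain K where "K \<in> \<K>" "X \<in> K" using \<open>X \<in> A\<close> sub by blast
    moreover from this obtain X' Y' where "K \<inter> A = {X'}" "K \<inter> B = {Y'}" "R X' Y'"
      using pair[of K] \<open>X \<in> A\<close> by blast
    moreover from calculation have "X' = X" using \<open>X \<in> A\<close> by (metis IntI singletonD)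
    ultimately show ?thesis unfolding Q_def by blast
  qed
  have Q2: "\<exists>X. Q X Y" if "Y \<in> B" for Y
  proof -
    obtain K where "K \<in> \<K>" "Y \<in> K" using \<open>Y \<in> B\<close> sub by blast
    moreover from this obtain X' Y' where "K \<inter> A = {X'}" "K \<inter> B = {Y'}" "R X' Y'"
      using pair[of K] \<open>Y \<in> B\<close> by blast
    moreover from calculation have "Y' = Y" using \<open>Y \<in> B\<close> by (metis IntI singletonD)
    ultimately show ?thesis unfolding Q_def by blast
  qed
  have QAB: "X \<in> A" "Y \<in> B" "R X Y" if "Q X Y" for X Y using that unfolding Q_def by auto
  have inj: "X = X'" if "Q X Y" "Q X' Y" for X X' Y
  proof -
    obtain K K' where K: "K \<in> \<K>" "K \<inter> A = {X}" "K \<inter> B = {Y}" "K' \<in> \<K>" "K' \<inter> A = {X'}" "K' \<inter> B = {Y}"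
      using \<open>Q X Y\<close> \<open>Q X' Y\<close> unfolding Q_def by blast
    then have "K = K'" by (metis disj IntD1 singletonI)
    then show ?thesis using K by (metis singleton_inject)
  qed
  have fn: "Y = Y'" if "Q X Y" "Q X Y'" for X Y Y'
  proof -
    obtain K K' where K: "K \<in> \<K>" "K \<inter> A = {X}" "K \<inter> B = {Y}" "K' \<in> \<K>" "K' \<inter> A = {X}" "K' \<inter> B = {Y'}"
      using \<open>Q X Y\<close> \<open>Q X Y'\<close> unfolding Q_def by blast
    then have "K = K'" by (metis disj IntD1 singletonI)
    then show ?thesis using K by (metis singleton_inject)
  qed
  obtain \<phi> where \<phi>: "\<And>X. X \<in> A \<Longrightarrow> Q X (\<phi> X)" using Q1 by metis
  have "inj_on \<phi> A" using \<phi> inj by (metis inj_onI)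
  moreover have "\<phi> ` A = B"
  proof (intro equalityI subsetI)
    fix Y assume "Y \<in> B"
    then obtain X where "Q X Y" using Q2 by blast
    then show "Y \<in> \<phi> ` A" using \<phi> fn QAB by blast
  qed (use \<phi> QAB in blast)
  ultimately show ?thesis using \<phi> QAB unfolding bij_betw_def by blast
qed

text \<open>Here \<open>s\<close> is the orientation of the cycle \<open>D\<close>, and \<alpha>,
  \<beta>, \<gamma> are the outcomes of the three remaining games. Going round \<alpha>, \<beta>,
  \<gamma>, a nonconstant pattern changes value exactly twice, once to \<open>s\<close> and once to
  its negation. The first change marks the triangle that is neutral before the flip of
  \<open>D\<close>, the second the one that is neutral after it.\<close>

lemma class_alternative:
  fixes s \<alpha> \<beta> \<gamma> :: bool
  assumes P: "P X1 \<longleftrightarrow> s = \<beta> \<and> \<beta> \<noteq> \<alpha>" "P X2 \<longleftrightarrow> s = \<gamma> \<and> \<gamma> \<noteq> \<beta>" "P X3 \<longleftrightarrow> s = \<alpha> \<and> \<alpha> \<noteq> \<gamma>"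
    and Q: "Q X1 \<longleftrightarrow> s \<noteq> \<beta> \<and> \<beta> \<noteq> \<alpha>" "Q X2 \<longleftrightarrow> s \<noteq> \<gamma> \<and> \<gamma> \<noteq> \<beta>" "Q X3 \<longleftrightarrow> s \<noteq> \<alpha> \<and> \<alpha> \<noteq> \<gamma>"
    and D: "\<And>e. e \<in> D \<longleftrightarrow> ((e \<in> X1) \<noteq> ((e \<in> X2) \<noteq> (e \<in> X3)))"
  shows "({X1, X2, X3} \<inter> Collect P = {} \<and> {X1, X2, X3} \<inter> Collect Q = {}) \<or>
    (\<exists>X Y Z. {X1, X2, X3} \<inter> Collect P = {X} \<and> {X1, X2, X3} \<inter> Collect Q = {Y} \<and>
       Z \<in> {X1, X2, X3} \<and> (\<forall>e. e \<in> D \<longleftrightarrow> ((e \<in> X) \<noteq> ((e \<in> Y) \<noteq> (e \<in> Z)))))"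
    (is "?none \<or> ?one")
proof (cases "\<alpha> = \<beta> \<and> \<beta> = \<gamma>")
  case True
  then show ?thesis using P Q by auto
next
  case False
  have pick: ?one if "P X" "\<not> P Y" "\<not> P Z" "\<not> Q X" "Q Y" "\<not> Q Z" "{X, Y, Z} = {X1, X2, X3}"
    "\<And>e. e \<in> D \<longleftrightarrow> ((e \<in> X) \<noteq> ((e \<in> Y) \<noteq> (e \<in> Z)))" for X Y Z
  proof (intro exI conjI)
    show "{X1, X2, X3} \<inter> Collect P = {X}" "{X1, X2, X3} \<inter> Collect Q = {Y}" "Z \<in> {X1, X2, X3}"
      unfolding that(7)[symmetric] using that(1-6) by auto
    show "\<forall>e. e \<in> D \<longleftrightarrow> ((e \<in> X) \<noteq> ((e \<in> Y) \<noteq> (e \<in> Z)))" using that(8) by blast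
  qed
  have perm: "{X1, X2, X3} = {X1, X2, X3}" "{X1, X3, X2} = {X1, X2, X3}" "{X2, X1, X3} = {X1, X2, X3}"
    "{X2, X3, X1} = {X1, X2, X3}" "{X3, X1, X2} = {X1, X2, X3}" "{X3, X2, X1} = {X1, X2, X3}"
    by auto
  have D': "e \<in> D \<longleftrightarrow> ((e \<in> X1) \<noteq> ((e \<in> X3) \<noteq> (e \<in> X2)))" "e \<in> D \<longleftrightarrow> ((e \<in> X2) \<noteq> ((e \<in> X1) \<noteq> (e \<in> X3)))"
    "e \<in> D \<longleftrightarrow> ((e \<in> X2) \<noteq> ((e \<in> X3) \<noteq> (e \<in> X1)))" "e \<in> D \<longleftrightarrow> ((e \<in> X3) \<noteq> ((e \<in> X1) \<noteq> (e \<in> X2)))"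
    "e \<in> D \<longleftrightarrow> ((e \<in> X3) \<noteq> ((e \<in> X2) \<noteq> (e \<in> X1)))" for e
    using D[of e] by auto
  \<comment> \<open>The cases record which outcome is the odd one out and whether it agrees with
    \<open>s\<close>.\<close>
  consider "\<alpha> = \<beta>" "s = \<gamma>" "\<gamma> \<noteq> \<beta>" | "\<alpha> = \<beta>" "s \<noteq> \<gamma>" "\<gamma> \<noteq> \<beta>" | "\<beta> = \<gamma>" "s = \<alpha>" "\<alpha> \<noteq> \<beta>"
    | "\<beta> = \<gamma>" "s \<noteq> \<alpha>" "\<alpha> \<noteq> \<beta>" | "\<alpha> = \<gamma>" "s = \<beta>" "\<beta> \<noteq> \<alpha>" | "\<alpha> = \<gamma>" "s \<noteq> \<beta>" "\<beta> \<noteq> \<alpha>"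
    using False by blast
  then have ?one
  proof cases
    case 1 then show ?thesis using P Q by (intro pick[of X2 X3 X1] perm D'(3)) auto
  next
    case 2 then show ?thesis using P Q by (intro pick[of X3 X2 X1] perm D'(5)) auto
  next
    case 3 then show ?thesis using P Q by (intro pick[of X3 X1 X2] perm D'(4)) auto
  next
    case 4 then show ?thesis using P Q by (intro pick[of X1 X3 X2] perm D'(1)) auto
  next
    case 5 then show ?thesis using P Q by (intro pick[of X1 X2 X3] perm D) auto
  next
    case 6 then show ?thesis using P Q by (intro pick[of X2 X1 X3] perm D'(2)) auto
  qed
  then show ?thesis ..
qed

text \<open>\<open>e1\<close>, \<open>e2\<close>, \<open>e3\<close> form the base of a tetrahedron
  and \<open>f1\<close>, \<open>f2\<close>, \<open>f3\<close> join it to the apex. Each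
  \<open>f\<close> lies on two side triangles and cancels.\<close>

lemma four_triangles_cover_twice:
  assumes "distinct [e1, e2, e3, f1, f2, f3]"
  shows "e \<in> {e1, e2, e3} \<longleftrightarrow> ((e \<in> {e1, f2, f1}) \<noteq> ((e \<in> {e2, f3, f2}) \<noteq> (e \<in> {e3, f1, f3})))"
  using assms by auto

text \<open>
  The triples of generators meeting \<open>trigon a b c\<close>. The mirror class is needed only if
  none of the three players is \<open>0\<close>: otherwise it contains \<open>trigon a b c\<close> itself, and its other
  members are never neutral together with it.
\<close>

definition apex_class :: "int \<Rightarrow> int \<Rightarrow> int \<Rightarrow> int \<Rightarrow> edge set set" where
  "apex_class a b c z = {trigon a b z, trigon b c z, trigon c a z}"

definition mirror_class :: "int \<Rightarrow> int \<Rightarrow> int \<Rightarrow> edge set set" where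
  "mirror_class a b c = {trigon a b (- c), trigon c a (- b), trigon b c (- a)}"

section \<open>Disjointness of the classes\<close>

lemma game_neq:
  assumes "\<bar>v\<bar> \<noteq> \<bar>z\<bar>" "\<bar>p\<bar> \<noteq> \<bar>q\<bar>" "\<bar>z\<bar> \<noteq> \<bar>p\<bar>" "\<bar>z\<bar> \<noteq> \<bar>q\<bar>"
  shows "game v z \<noteq> game p q"
  using assms(3,4) unfolding game_eq_iff[OF assms(1,2)] by auto

lemma game_eqD:
  assumes "game v z = game v' z'" "\<bar>v\<bar> \<noteq> \<bar>z\<bar>" "\<bar>v'\<bar> \<noteq> \<bar>z'\<bar>" "\<bar>v'\<bar> \<noteq> \<bar>z\<bar>"
  shows "(z = z' \<and> v = v') \<or> (z = - z' \<and> - v = v')"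
  using assms by (auto simp: game_eq_iff)

text \<open>The two games of \<open>X\<close> at the apex \<open>z\<close> must also be games at
  \<open>z'\<close>, so \<open>z = z'\<close> or \<open>z = - z'\<close>. In the latter case the
  negatives of both base players would again lie among \<open>a\<close>, \<open>b\<close>,
  \<open>c\<close>, which forces both players to be \<open>0\<close>.\<close>

lemma apex_class_disjoint:
  assumes t: "triple \<Phi> a b c"
    and z: "\<bar>z\<bar> \<noteq> \<bar>a\<bar>" "\<bar>z\<bar> \<noteq> \<bar>b\<bar>" "\<bar>z\<bar> \<noteq> \<bar>c\<bar>"
    and z': "\<bar>z'\<bar> \<noteq> \<bar>a\<bar>" "\<bar>z'\<bar> \<noteq> \<bar>b\<bar>" "\<bar>z'\<bar> \<noteq> \<bar>c\<bar>"
    and X: "X \<in> apex_class a b c z" "X \<in> apex_class a b c z'"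
  shows "z = z'"
proof -
  have zw: "\<bar>w\<bar> \<noteq> \<bar>z\<bar>" "\<bar>w\<bar> \<noteq> \<bar>z'\<bar>" if "w \<in> {a, b, c}" for w
    using that z z' by (metis insertE emptyE)+
  have *: "z = z'" if "\<bar>u\<bar> \<noteq> \<bar>v\<bar>" "trigon u v z = trigon u' v' z'"
     "u \<in> {a,b,c}" "v \<in> {a,b,c}" "u' \<in> {a,b,c}" "v' \<in> {a,b,c}" "\<bar>u'\<bar> \<noteq> \<bar>v'\<bar>" for u v u' v'
  proof -
    have "game v z \<in> trigon u' v' z'" "game z u \<in> trigon u' v' z'"
      using that(2) unfolding trigon_def by blast+
    moreover have ne: "\<bar>z\<bar> \<noteq> \<bar>u\<bar>" "\<bar>v\<bar> \<noteq> \<bar>z\<bar>" "\<bar>z'\<bar> \<noteq> \<bar>u'\<bar>" "\<bar>v'\<bar> \<noteq> \<bar>z'\<bar>"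
      "\<bar>z\<bar> \<noteq> \<bar>u'\<bar>" "\<bar>v'\<bar> \<noteq> \<bar>z\<bar>" "\<bar>z'\<bar> \<noteq> \<bar>u\<bar>" "\<bar>v\<bar> \<noteq> \<bar>z'\<bar>"
      using zw[OF that(3)] zw[OF that(4)] zw[OF that(5)] zw[OF that(6)] by metis+
    moreover have "game v z \<noteq> game u' v'" "game z u \<noteq> game u' v'"
      unfolding game_eq_iff[OF ne(1) that(7)] game_eq_iff[OF ne(2) that(7)] using ne by auto
    ultimately have "game v z = game v' z' \<or> game v z = game z' u'"
      "game z u = game v' z' \<or> game z u = game z' u'"
      unfolding trigon_def by blast+
    moreover have "(z = z' \<and> y = y') \<or> (z = - z' \<and> - y = y')"
      if "game y z = game y' z'" "y \<in> {u, v}" "y' \<in> {u', v'}" for y y'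
      using that ne by (intro game_eqD) auto
    ultimately have "(z = z' \<and> v \<in> {u', v'}) \<or> (z = - z' \<and> - v \<in> {u', v'})"
      "(z = z' \<and> u \<in> {u', v'}) \<or> (z = - z' \<and> - u \<in> {u', v'})"
      using game_commute by (metis insertI1 insertI2)+
    moreover have "- v \<in> {a, b, c} \<Longrightarrow> v = 0" "- u \<in> {a, b, c} \<Longrightarrow> u = 0"
      using that(3,4) t unfolding triple_def by (auto simp: abs_if split: if_splits)
    ultimately show ?thesis using that(1,5,6) by (auto simp only: insert_iff empty_iff)
  qed
  show ?thesis
    using X t * unfolding apex_class_def triple_def by (elim insertE) (auto simp only: insert_iff empty_iff)
qed

text \<open>A triangle with apex \<open>z\<close> contains a game of \<open>z\<close>, while mirror
  triangles involve only players that are \<open>a\<close>, \<open>b\<close> or \<open>c\<close> up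
  to sign.\<close>

lemma apex_mirror_disjoint:
  assumes t: "triple \<Phi> a b c"
    and z: "\<bar>z\<bar> \<noteq> \<bar>a\<bar>" "\<bar>z\<bar> \<noteq> \<bar>b\<bar>" "\<bar>z\<bar> \<noteq> \<bar>c\<bar>"
    and X: "X \<in> apex_class a b c z"
  shows "X \<notin> mirror_class a b c"
proof -
  have "\<exists>v\<in>{a, b, c}. game v z \<in> X"
    using X unfolding apex_class_def by (auto simp: trigon_def)
  moreover have "game v z \<notin> Y" if v: "v \<in> {a, b, c}" and Y: "Y \<in> mirror_class a b c" for v Y
  proof -
    have vz: "\<bar>v\<bar> \<noteq> \<bar>z\<bar>" using v z by (metis insertE emptyE)
    have ne: "game v z \<noteq> game p q" if "\<bar>p\<bar> \<in> {\<bar>a\<bar>, \<bar>b\<bar>, \<bar>c\<bar>}" "\<bar>q\<bar> \<in> {\<bar>a\<bar>, \<bar>b\<bar>, \<bar>c\<bar>}" "\<bar>p\<bar> \<noteq> \<bar>q\<bar>" for p q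
      using that z by (intro game_neq[OF vz]) (metis insertE emptyE)+
    have "game v z \<notin> trigon p q r" if "\<bar>p\<bar> \<in> {\<bar>a\<bar>, \<bar>b\<bar>, \<bar>c\<bar>}" "\<bar>q\<bar> \<in> {\<bar>a\<bar>, \<bar>b\<bar>, \<bar>c\<bar>}"
      "\<bar>r\<bar> \<in> {\<bar>a\<bar>, \<bar>b\<bar>, \<bar>c\<bar>}" "\<bar>p\<bar> \<noteq> \<bar>q\<bar>" "\<bar>q\<bar> \<noteq> \<bar>r\<bar>" "\<bar>r\<bar> \<noteq> \<bar>p\<bar>" for p q r
      using ne that unfolding trigon_def by blast
    from this[of a b "- c"] this[of c a "- b"] this[of b c "- a"]
    have "game v z \<notin> trigon a b (- c)" "game v z \<notin> trigon c a (- b)" "game v z \<notin> trigon b c (- a)"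
      using t by (simp_all add: triple_def)
    then show ?thesis using Y unfolding mirror_class_def by blast
  qed
  ultimately show ?thesis by blast
qed

text \<open>Flipping \<open>D\<close> reverses the base of the tetrahedron on \<open>a\<close>,
  \<open>b\<close>, \<open>c\<close>, \<open>z\<close> and leaves the three games against
  \<open>z\<close> alone. Their outcomes are the \<alpha>, \<beta>, \<gamma> of
  \<open>class_alternative\<close>.\<close>

lemma apex_class_alternative:
  assumes x: "x \<in> tournaments \<Phi>" and t: "triple \<Phi> a b c" and D: "D = trigon a b c"
    and copy: "generator_copy \<Phi> x D"
    and z: "z \<in> players \<Phi>" "\<bar>z\<bar> \<noteq> \<bar>a\<bar>" "\<bar>z\<bar> \<noteq> \<bar>b\<bar>" "\<bar>z\<bar> \<noteq> \<bar>c\<bar>"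
    and y: "y = flip x D" and K: "K = apex_class a b c z"
  shows "(K \<inter> Collect (generator_copy \<Phi> x) = {} \<and> K \<inter> Collect (generator_copy \<Phi> y) = {}) \<or>
    (\<exists>X Y Z. K \<inter> Collect (generator_copy \<Phi> x) = {X} \<and> K \<inter> Collect (generator_copy \<Phi> y) = {Y} \<and>
       Z \<in> K \<and> (\<forall>e. e \<in> D \<longleftrightarrow> ((e \<in> X) \<noteq> ((e \<in> Y) \<noteq> (e \<in> Z)))))"
proof -
  have yt: "y \<in> tournaments \<Phi>" unfolding y D using flip_tournament[OF x] trigon_subset_edges[OF t] .
  note pl = t[unfolded triple_def]
  have tz: "triple \<Phi> a b z" "triple \<Phi> b c z" "triple \<Phi> c a z" using t z unfolding triple_def by metis+
  have sx: "beats x b c = beats x a b" "beats x c a = beats x a b"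
    using copy generator_copy_trigon_iff[OF x t] D by auto
  have sy: "beats y a b = (\<not> beats x a b)" "beats y b c = (\<not> beats x a b)" "beats y c a = (\<not> beats x a b)"
    using beats_flip_tournament[OF x, of a b D] beats_flip_tournament[OF x, of b c D]
      beats_flip_tournament[OF x, of c a D] pl sx unfolding y D trigon_def by (metis insertI1 insertI2)+
  have nD: "game v z \<notin> D" if "v \<in> {a, b, c}" for v
  proof -
    have "\<bar>v\<bar> \<noteq> \<bar>z\<bar>" using that z by (metis insertE emptyE)
    then show ?thesis using game_neq pl z(2-4) unfolding D trigon_def by (metis insertE emptyE)
  qed
  have bz: "beats y v z = beats x v z" "beats y z v = (\<not> beats x v z)" "beats x z v = (\<not> beats x v z)" if "v \<in> {a, b, c}" for v
  proof -
    have v: "v \<in> players \<Phi>" "\<bar>v\<bar> \<noteq> \<bar>z\<bar>" using that pl z by (metis insertE emptyE)+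
    then show "beats y v z = beats x v z" "beats y z v = (\<not> beats x v z)" "beats x z v = (\<not> beats x v z)"
      using beats_flip_tournament[OF x v(1) z(1) v(2), of D] nD[OF that] beats_commute[OF v(2)]
      unfolding y by auto
  qed
  have mem: "a \<in> {a, b, c}" "b \<in> {a, b, c}" "c \<in> {a, b, c}" by auto
  show ?thesis
    unfolding K apex_class_def
  proof (rule class_alternative[where s = "beats x a b" and \<alpha> = "beats x a z" and \<beta> = "beats x b z" and \<gamma> = "beats x c z"])
    show "e \<in> D \<longleftrightarrow> ((e \<in> trigon a b z) \<noteq> ((e \<in> trigon b c z) \<noteq> (e \<in> trigon c a z)))" for e
    proof -
      have ne: "game a b \<noteq> game b c" "game b c \<noteq> game c a" "game c a \<noteq> game a b"
        using trigon_games_distinct pl by blast+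
      have nz: "game a z \<noteq> game b z" "game b z \<noteq> game c z" "game c z \<noteq> game a z"
        using trigon_games_distinct[of a b z] trigon_games_distinct[of b c z] trigon_games_distinct[of c a z] pl z
        by (metis game_commute)+
      show ?thesis
        unfolding D trigon_def game_commute[of z]
        using ne nz nD[OF mem(1)] nD[OF mem(2)] nD[OF mem(3)] unfolding D trigon_def
        by (intro four_triangles_cover_twice) (simp, metis)
    qed
  qed (simp_all add: generator_copy_trigon_iff[OF x] generator_copy_trigon_iff[OF yt] tz sx sy bz[OF mem(1)]
        bz[OF mem(2)] bz[OF mem(3)], blast+)
qed

text \<open>There is no fourth player: the games of \<open>a\<close> with \<open>- b\<close>,
  \<open>b\<close> with \<open>- c\<close> and \<open>c\<close> with \<open>- a\<close> take the
  place of the games at the apex. Each lies in two of the triangles because negating both players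
  leaves a game unchanged, and none lies in \<open>D\<close> because the three players are
  nonzero.\<close>

lemma mirror_class_alternative:
  assumes x: "x \<in> tournaments \<Phi>" and t: "triple \<Phi> a b c" and D: "D = trigon a b c"
    and copy: "generator_copy \<Phi> x D"
    and nz: "a \<noteq> 0" "b \<noteq> 0" "c \<noteq> 0"
    and y: "y = flip x D" and K: "K = mirror_class a b c"
  shows "(K \<inter> Collect (generator_copy \<Phi> x) = {} \<and> K \<inter> Collect (generator_copy \<Phi> y) = {}) \<or>
    (\<exists>X Y Z. K \<inter> Collect (generator_copy \<Phi> x) = {X} \<and> K \<inter> Collect (generator_copy \<Phi> y) = {Y} \<and>
       Z \<in> K \<and> (\<forall>e. e \<in> D \<longleftrightarrow> ((e \<in> X) \<noteq> ((e \<in> Y) \<noteq> (e \<in> Z)))))"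
proof -
  have yt: "y \<in> tournaments \<Phi>" unfolding y D using flip_tournament[OF x] trigon_subset_edges[OF t] .
  note pl = t[unfolded triple_def]
  have tm: "triple \<Phi> a b (- c)" "triple \<Phi> c a (- b)" "triple \<Phi> b c (- a)"
    using t unfolding triple_def abs_minus_cancel players_uminus by metis+
  have sx: "beats x b c = beats x a b" "beats x c a = beats x a b"
    using copy generator_copy_trigon_iff[OF x t] D by auto
  have sy: "beats y a b = (\<not> beats x a b)" "beats y b c = (\<not> beats x a b)" "beats y c a = (\<not> beats x a b)"
    using beats_flip_tournament[OF x, of a b D] beats_flip_tournament[OF x, of b c D]
      beats_flip_tournament[OF x, of c a D] pl sx unfolding y D trigon_def by (metis insertI1 insertI2)+
  have g: "game (- c) a = game c (- a)" "game (- b) c = game b (- c)" "game (- a) b = game a (- b)"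
    using game_uminus[of c "- a"] game_uminus[of b "- c"] game_uminus[of a "- b"] by simp_all
  have ne1: "game a b \<noteq> game b c" "game b c \<noteq> game c a" "game c a \<noteq> game a b"
    using trigon_games_distinct pl by blast+
  have ne2: "game a b \<noteq> game b (- c)" "game b (- c) \<noteq> game c (- a)" "game c (- a) \<noteq> game a b"
    using trigon_games_distinct[of a b "- c"] pl unfolding g abs_minus_cancel by blast+
  have ne3: "game b c \<noteq> game c (- a)" "game c (- a) \<noteq> game a (- b)" "game a (- b) \<noteq> game b c"
    using trigon_games_distinct[of b c "- a"] pl unfolding g abs_minus_cancel by blast+
  have ne4: "game c a \<noteq> game a (- b)" "game a (- b) \<noteq> game b (- c)" "game b (- c) \<noteq> game c a"
    using trigon_games_distinct[of c a "- b"] pl unfolding g abs_minus_cancel by blast+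
  have ne5: "game u (- v) \<noteq> game u v" if "\<bar>u\<bar> \<noteq> \<bar>v\<bar>" "u \<noteq> 0" "v \<noteq> 0" for u v
  proof -
    have "\<bar>u\<bar> \<noteq> \<bar>- v\<bar>" using that by simp
    from game_eq_iff[OF this that(1)] show ?thesis using that by auto
  qed
  have ne6: "game a (- b) \<noteq> game a b" "game b (- c) \<noteq> game b c" "game c (- a) \<noteq> game c a"
    using ne5 pl nz by blast+
  have nD: "game a (- b) \<notin> D" "game b (- c) \<notin> D" "game c (- a) \<notin> D"
    unfolding D trigon_def using ne2 ne3 ne4 ne6 by auto
  \<comment> \<open>The two triangles that share a mirror game traverse it in opposite
    directions.\<close>
  have m: "beats w (- v) u = (\<not> beats w v (- u))" if "\<bar>u\<bar> \<noteq> \<bar>v\<bar>" for w u v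
    using beats_commute[of u "- v" w] beats_uminus[of u "- v" w] that by simp
  have my: "beats y u (- v) = beats x u (- v)"
    if "u \<in> players \<Phi>" "v \<in> players \<Phi>" "\<bar>u\<bar> \<noteq> \<bar>v\<bar>" "game u (- v) \<notin> D" for u v
    using beats_flip_tournament[OF x, of u "- v" D] that unfolding y by simp
  have my': "beats y a (- b) = beats x a (- b)" "beats y b (- c) = beats x b (- c)" "beats y c (- a) = beats x c (- a)"
    using my nD pl by blast+
  have m': "beats w (- c) a = (\<not> beats w c (- a))" "beats w (- b) c = (\<not> beats w b (- c))"
     "beats w (- a) b = (\<not> beats w a (- b))" for w
    using m pl by metis+
  show ?thesis
    unfolding K mirror_class_def
  proof (rule class_alternative[where s = "beats x a b" and \<alpha> = "beats x c (- a)" and \<beta> = "beats x b (- c)" and \<gamma> = "beats x a (- b)"])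
    show "e \<in> D \<longleftrightarrow> ((e \<in> trigon a b (- c)) \<noteq> ((e \<in> trigon c a (- b)) \<noteq> (e \<in> trigon b c (- a))))" for e
    proof -
      have "D = {game a b, game c a, game b c}" unfolding D trigon_def by blast
      moreover have "trigon a b (- c) = {game a b, game b (- c), game c (- a)}"
        "trigon c a (- b) = {game c a, game a (- b), game b (- c)}"
        "trigon b c (- a) = {game b c, game c (- a), game a (- b)}"
        unfolding trigon_def g by blast+
      moreover have "distinct [game a b, game c a, game b c, game c (- a), game b (- c), game a (- b)]"
        using ne1 ne2 ne3 ne4 ne6 by auto
      ultimately show ?thesis using four_triangles_cover_twice by metis
    qed
  qed (simp_all add: generator_copy_trigon_iff[OF x] generator_copy_trigon_iff[OF yt] tm sx sy m' my', blast+)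
qed


text \<open>A player beats \<open>0\<close> exactly when its negative loses to \<open>0\<close>. So
  replacing \<open>c\<close> by \<open>- c\<close> reverses the arc between this vertex and
  \<open>0\<close>, while the arc between \<open>a\<close> and \<open>b\<close> is kept, and the
  cycle breaks.\<close>

lemma mirror_nonneutral_if_zero:
  assumes x: "x \<in> tournaments \<Phi>" and t: "triple \<Phi> a b c" and copy: "generator_copy \<Phi> x (trigon a b c)"
    and z: "a = 0 \<or> b = 0"
  shows "\<not> generator_copy \<Phi> x (trigon a b (- c))"
proof
  note pl = t[unfolded triple_def]
  have tm: "triple \<Phi> a b (- c)"
    using t unfolding triple_def abs_minus_cancel players_uminus by metis
  assume "generator_copy \<Phi> x (trigon a b (- c))"
  then have "beats x b (- c) = beats x b c" "beats x (- c) a = beats x c a"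
    using copy generator_copy_trigon_iff[OF x t] generator_copy_trigon_iff[OF x tm] by auto
  moreover have "beats x 0 (- c) = (\<not> beats x 0 c)" if "c \<noteq> 0"
    using beats_uminus[of c 0 x] beats_commute[of c 0 x] that by simp
  moreover have "beats x (- c) 0 = (\<not> beats x c 0)" if "c \<noteq> 0"
    using beats_uminus[of 0 c x] beats_commute[of 0 c x] that by simp
  ultimately show False using z pl by auto
qed

text \<open>A game shared with the triangle leaves only the third vertex of \<open>X\<close> free.
  If its absolute value is new, it is an apex; otherwise it is the negative of the remaining vertex,
  and then no vertex can be \<open>0\<close>.\<close>

lemma generator_meeting_trigon:
  assumes x: "x \<in> tournaments \<Phi>" and t: "triple \<Phi> a b c" and copy: "generator_copy \<Phi> x (trigon a b c)"
    and X: "generator_copy \<Phi> x X" "X \<noteq> trigon a b c" "X \<inter> trigon a b c \<noteq> {}"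
  shows "(\<exists>z\<in>players \<Phi>. \<bar>z\<bar> \<noteq> \<bar>a\<bar> \<and> \<bar>z\<bar> \<noteq> \<bar>b\<bar> \<and> \<bar>z\<bar> \<noteq> \<bar>c\<bar> \<and> X \<in> apex_class a b c z) \<or>
    (a \<noteq> 0 \<and> b \<noteq> 0 \<and> c \<noteq> 0 \<and> X \<in> mirror_class a b c)"
proof -
  have *: "\<exists>z\<in>players \<Phi>. \<bar>z\<bar> \<noteq> \<bar>a\<bar> \<and> \<bar>z\<bar> \<noteq> \<bar>b\<bar> \<and> \<bar>z\<bar> \<noteq> \<bar>c\<bar> \<and> X = trigon a b z \<or>
      z = - c \<and> a \<noteq> 0 \<and> b \<noteq> 0 \<and> c \<noteq> 0 \<and> X = trigon a b z"
    if t: "triple \<Phi> a b c" and copy: "generator_copy \<Phi> x (trigon a b c)"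
      and X: "generator_copy \<Phi> x X" "X \<noteq> trigon a b c" "game a b \<in> X" for a b c
  proof -
    obtain z where z: "triple \<Phi> a b z" "X = trigon a b z"
      using generator_through_game[of \<Phi> X a b] X t by (auto simp: generator_copy_def triple_def)
    have "z \<noteq> c" using X(2) z by blast
    show ?thesis
    proof (cases "\<bar>z\<bar> = \<bar>c\<bar>")
      case True
      then have "z = - c" "c \<noteq> 0" using \<open>z \<noteq> c\<close> by auto
      moreover have "a \<noteq> 0 \<and> b \<noteq> 0"
        using mirror_nonneutral_if_zero[OF x t copy] X(1) z(2) \<open>z = - c\<close> by blast
      ultimately show ?thesis using z unfolding triple_def by blast
    next
      case False
      then show ?thesis using z unfolding triple_def by metis
    qed
  qed
  have tr: "triple \<Phi> b c a" "triple \<Phi> c a b" using t triple_rotate by blast+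
  have rot: "trigon b c a = trigon a b c" "trigon c a b = trigon a b c" using trigon_rotate by metis+
  from X(3) consider "game a b \<in> X" | "game b c \<in> X" | "game c a \<in> X"
    unfolding trigon_def by blast
  then show ?thesis
  proof cases
    case 1
    then show ?thesis using *[OF t copy X(1,2)] unfolding apex_class_def mirror_class_def by blast
  next
    case 2
    then show ?thesis using *[OF tr(1), unfolded rot, OF copy X(1,2)]
      unfolding apex_class_def mirror_class_def by blast
  next
    case 3
    then show ?thesis using *[OF tr(2), unfolded rot, OF copy X(1,2)]
      unfolding apex_class_def mirror_class_def by blast
  qed
qed

lemma mirror_game_notin_trigon:
  assumes t: "triple \<Phi> a b c" and "a \<noteq> 0" "b \<noteq> 0"
  shows "game a (- b) \<notin> trigon a b c"
proof -
  note pl = t[unfolded triple_def]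
  have ab: "\<bar>a\<bar> \<noteq> \<bar>- b\<bar>" "\<bar>a\<bar> \<noteq> \<bar>b\<bar>" using pl by auto
  have "game a (- b) \<noteq> game a b" using game_eq_iff[OF ab] assms(2,3) by auto
  moreover have "game b c \<noteq> game a (- b)" "game a c \<noteq> game a (- b)"
    using pl by (intro game_neq; simp)+
  ultimately show ?thesis unfolding trigon_def game_commute[of c a] by auto
qed

text \<open>The generators are sorted into singletons of those disjoint from \<open>D\<close>, apex
  classes and the mirror class. \<open>D\<close> is left out on both sides, since it is the copy
  that exchanges \<open>x\<close> and \<open>y\<close>.\<close>

lemma interchange_bijection:
  assumes x: "x \<in> IntGr_verts \<Phi> s" and copy: "generator_copy \<Phi> x D" and y: "y = flip x D"
  shows "\<exists>\<phi>. bij_betw \<phi> ({X. generator_copy \<Phi> x X} - {D}) ({X. generator_copy \<Phi> y X} - {D}) \<and>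
    (\<forall>X \<in> {X. generator_copy \<Phi> x X} - {D}. IntGr_adj \<Phi> (flip x X) (flip y (\<phi> X)))"
proof -
  have xt: "x \<in> tournaments \<Phi>" using x by (simp add: IntGr_verts_def)
  have D_gen: "generator_games \<Phi> D" using copy by (simp add: generator_copy_def)
  have DE: "D \<subseteq> edges \<Phi>" using generator_games_subset_edges[OF D_gen] .
  obtain a b c where t: "triple \<Phi> a b c" and D: "D = trigon a b c"
    using D_gen generator_games_iff by blast
  note pl = t[unfolded triple_def]
  have yv: "y \<in> IntGr_verts \<Phi> s" unfolding y using flip_copy_in_verts[OF x copy] .
  then have yt: "y \<in> tournaments \<Phi>" by (simp add: IntGr_verts_def)
  have copy_y: "generator_copy \<Phi> y D" unfolding y using flip_copy_flip(2)[OF x copy] .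
  define A where "A = {X. generator_copy \<Phi> x X} - {D}"
  define B where "B = {X. generator_copy \<Phi> y X} - {D}"
  define singles where "singles = {{X} | X. generator_games \<Phi> X \<and> X \<inter> D = {}}"
  define apexes where "apexes = {apex_class a b c z | z. z \<in> players \<Phi> \<and> \<bar>z\<bar> \<noteq> \<bar>a\<bar> \<and> \<bar>z\<bar> \<noteq> \<bar>b\<bar> \<and> \<bar>z\<bar> \<noteq> \<bar>c\<bar>}"
  \<comment> \<open>At most a singleton; a vertex \<open>0\<close> yields no mirror class.\<close>
  define mirrors where "mirrors = {K. K = mirror_class a b c \<and> a \<noteq> 0 \<and> b \<noteq> 0 \<and> c \<noteq> 0}"
  define \<K> where "\<K> = singles \<union> apexes \<union> mirrors"
  have meet: "X \<inter> D \<noteq> {}" if "X \<in> K" "K \<in> apexes \<union> mirrors" for X K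
    using that unfolding D apexes_def mirrors_def apex_class_def mirror_class_def trigon_def by blast
  have gen: "generator_games \<Phi> X" if "X \<in> K" "K \<in> apexes \<union> mirrors" for X K
  proof -
    have "triple \<Phi> a b z" "triple \<Phi> b c z" "triple \<Phi> c a z"
      if "z \<in> players \<Phi>" "\<bar>z\<bar> \<noteq> \<bar>a\<bar>" "\<bar>z\<bar> \<noteq> \<bar>b\<bar>" "\<bar>z\<bar> \<noteq> \<bar>c\<bar>" for z
      using that t unfolding triple_def by metis+
    moreover have "triple \<Phi> a b (- c)" "triple \<Phi> c a (- b)" "triple \<Phi> b c (- a)"
      using t unfolding triple_def abs_minus_cancel players_uminus by metis+
    ultimately show ?thesis
      using that unfolding generator_games_iff apexes_def mirrors_def apex_class_def mirror_class_def by blast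
  qed
  have apex_neq_D: "D \<notin> K" if Ka: "K \<in> apexes" for K
  proof
    assume "D \<in> K"
    then obtain z where z: "\<bar>z\<bar> \<noteq> \<bar>a\<bar>" "\<bar>z\<bar> \<noteq> \<bar>b\<bar>" "\<bar>z\<bar> \<noteq> \<bar>c\<bar>" "D \<in> apex_class a b c z"
      using Ka unfolding apexes_def by blast
    then have "\<exists>v\<in>{a, b, c}. game v z \<in> D" unfolding apex_class_def trigon_def by blast
    then obtain v where v: "v \<in> {a, b, c}" "game v z \<in> trigon a b c" unfolding D by blast
    have "\<bar>v\<bar> \<noteq> \<bar>z\<bar>" using v z by (metis insertE emptyE)
    then show False using v(2) game_neq z(1-3) pl unfolding trigon_def by (metis insertE emptyE)
  qed
  have mirror_neq_D: "D \<notin> K" if "K \<in> mirrors" for K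
  proof
    assume "D \<in> K"
    then have nz: "a \<noteq> 0" "b \<noteq> 0" "c \<noteq> 0" and Dm: "D \<in> mirror_class a b c"
      using that unfolding mirrors_def by blast+
    have "game a (- b) \<in> D \<or> game b (- c) \<in> D \<or> game c (- a) \<in> D"
      using Dm unfolding mirror_class_def trigon_def by blast
    moreover have "game a (- b) \<notin> D" "game b (- c) \<notin> D" "game c (- a) \<notin> D"
      using mirror_game_notin_trigon nz t triple_rotate trigon_rotate unfolding D by metis+
    ultimately show False by blast
  qed
  have "\<exists>\<phi>. bij_betw \<phi> A B \<and> (\<forall>X\<in>A. IntGr_adj \<Phi> (flip x X) (flip y (\<phi> X)))"
  proof (rule bij_from_partition[where \<K> = \<K>])
    fix K K' X assume K: "K \<in> \<K>" "K' \<in> \<K>" "X \<in> K" "X \<in> K'"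
    have am: False if "L \<in> apexes" "L' \<in> mirrors" "X \<in> L" "X \<in> L'" for L L'
      using that apex_mirror_disjoint[OF t] unfolding apexes_def mirrors_def by blast
    have aa: "L = L'" if "L \<in> apexes" "L' \<in> apexes" "X \<in> L" "X \<in> L'" for L L'
      using that apex_class_disjoint[OF t] unfolding apexes_def by blast
    have mm: "L = L'" if "L \<in> mirrors" "L' \<in> mirrors" for L L'
      using that unfolding mirrors_def by blast
    have ss: "L = L'" if "L \<in> singles" "L' \<in> singles" "X \<in> L" "X \<in> L'" for L L'
      using that unfolding singles_def by blast
    have sd: "X \<inter> D = {}" if "L \<in> singles" "X \<in> L" for L
      using that unfolding singles_def by blast
    show "K = K'"
      using K am aa mm ss sd meet unfolding \<K>_def by (metis Un_iff)
  next
    have cov: "{X. generator_copy \<Phi> w X} - {D} \<subseteq> \<Union>\<K>"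
      if w: "w \<in> tournaments \<Phi>" "generator_copy \<Phi> w D" for w
    proof
      fix X assume X: "X \<in> {X. generator_copy \<Phi> w X} - {D}"
      show "X \<in> \<Union>\<K>"
      proof (cases "X \<inter> D = {}")
        case True
        then have "{X} \<in> singles" using X unfolding singles_def generator_copy_def by blast
        then show ?thesis unfolding \<K>_def by blast
      next
        case False
        then show ?thesis
          using generator_meeting_trigon[OF w(1) t, of X] w(2) X
          unfolding D \<K>_def apexes_def mirrors_def by blast
      qed
    qed
    show "A \<subseteq> \<Union>\<K>" "B \<subseteq> \<Union>\<K>"
      unfolding A_def B_def using cov xt yt copy copy_y by blast+
  next
    \<comment> \<open>\<open>D\<close> is the symmetric difference of \<open>X\<close>,
      \<open>Y\<close> and \<open>Z\<close>, so the two neighbours differ by a flip of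
      \<open>Z\<close>; its neutrality comes from the equality of scores.\<close>
    have adj: "IntGr_adj \<Phi> (flip x X) (flip y Y)"
      if "generator_copy \<Phi> x X" "generator_copy \<Phi> y Y" "generator_games \<Phi> Z"
        "\<forall>e. e \<in> D \<longleftrightarrow> ((e \<in> X) \<noteq> ((e \<in> Y) \<noteq> (e \<in> Z)))" for X Y Z
    proof -
      have XE: "X \<subseteq> edges \<Phi>" using that(1) generator_games_subset_edges by (auto simp: generator_copy_def)
      have "(X - Z) \<union> (Z - X) = (D - Y) \<union> (Y - D)" using that(4) by blast
      then have "flip y Y = flip (flip x X) Z"
        unfolding y flip_flip[OF xt XE] flip_flip[OF xt DE] by simp
      then show ?thesis
        using IntGr_adj_iff[OF flip_copy_in_verts[OF x that(1)] flip_copy_in_verts[OF yv that(2)]] that(3) by blast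
    qed
    have finish: "(K \<inter> A = {} \<and> K \<inter> B = {}) \<or>
        (\<exists>X Y. K \<inter> A = {X} \<and> K \<inter> B = {Y} \<and> IntGr_adj \<Phi> (flip x X) (flip y Y))"
      if K: "K \<in> apexes \<union> mirrors" "D \<notin> K"
        and alt: "(K \<inter> Collect (generator_copy \<Phi> x) = {} \<and> K \<inter> Collect (generator_copy \<Phi> y) = {}) \<or>
          (\<exists>X Y Z. K \<inter> Collect (generator_copy \<Phi> x) = {X} \<and> K \<inter> Collect (generator_copy \<Phi> y) = {Y} \<and>
          Z \<in> K \<and> (\<forall>e. e \<in> D \<longleftrightarrow> ((e \<in> X) \<noteq> ((e \<in> Y) \<noteq> (e \<in> Z)))))" for K
    proof -
      have KA: "K \<inter> A = K \<inter> Collect (generator_copy \<Phi> x)" "K \<inter> B = K \<inter> Collect (generator_copy \<Phi> y)"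
        using K(2) unfolding A_def B_def by blast+
      show ?thesis
        using alt unfolding KA
      proof (elim disjE exE conjE)
        fix X Y Z
        assume XYZ: "K \<inter> Collect (generator_copy \<Phi> x) = {X}" "K \<inter> Collect (generator_copy \<Phi> y) = {Y}"
          "Z \<in> K" "\<forall>e. e \<in> D \<longleftrightarrow> ((e \<in> X) \<noteq> ((e \<in> Y) \<noteq> (e \<in> Z)))"
        have "generator_copy \<Phi> x X" "generator_copy \<Phi> y Y"
          using XYZ(1,2) by (metis IntD2 mem_Collect_eq singletonI)+
        then have "IntGr_adj \<Phi> (flip x X) (flip y Y)"
          using adj gen[OF XYZ(3) K(1)] XYZ(4) by blast
        then show "(K \<inter> Collect (generator_copy \<Phi> x) = {} \<and> K \<inter> Collect (generator_copy \<Phi> y) = {}) \<or>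
          (\<exists>X Y. K \<inter> Collect (generator_copy \<Phi> x) = {X} \<and> K \<inter> Collect (generator_copy \<Phi> y) = {Y} \<and>
          IntGr_adj \<Phi> (flip x X) (flip y Y))"
          using XYZ(1,2) by blast
      qed blast
    qed
    fix K assume "K \<in> \<K>"
    then consider "K \<in> singles" | "K \<in> apexes" | "K \<in> mirrors" unfolding \<K>_def by blast
    then show "(K \<inter> A = {} \<and> K \<inter> B = {}) \<or>
      (\<exists>X Y. K \<inter> A = {X} \<and> K \<inter> B = {Y} \<and> IntGr_adj \<Phi> (flip x X) (flip y Y))"
    proof cases
      case 1
      then obtain X where X: "K = {X}" "generator_games \<Phi> X" "X \<inter> D = {}" unfolding singles_def by blast
      have "score_on X y = score_on X x"
        unfolding score_on_def y flip_def using X(3) by (intro ext sum.cong) auto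
      then have eq: "generator_copy \<Phi> y X \<longleftrightarrow> generator_copy \<Phi> x X"
        unfolding generator_copy_def neutral_def by simp
      have "X \<noteq> D" using X(3) generator_games_nonempty[OF D_gen] by blast
      show ?thesis
      proof (cases "generator_copy \<Phi> x X")
        case True
        \<comment> \<open>A generator disjoint from \<open>D\<close> is matched with itself, and the
          third set is \<open>D\<close>: the two flips commute.\<close>
        then have "IntGr_adj \<Phi> (flip x X) (flip y X)"
          using adj[OF True _ D_gen] eq by blast
        then show ?thesis using True eq X(1) \<open>X \<noteq> D\<close> unfolding A_def B_def by blast
      next
        case False
        then show ?thesis using eq X(1) unfolding A_def B_def by blast
      qed
    next
      case 2
      then obtain z where z: "z \<in> players \<Phi>" "\<bar>z\<bar> \<noteq> \<bar>a\<bar>" "\<bar>z\<bar> \<noteq> \<bar>b\<bar>" "\<bar>z\<bar> \<noteq> \<bar>c\<bar>" "K = apex_class a b c z"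
        unfolding apexes_def by blast
      show ?thesis
        by (rule finish[OF UnI1[OF 2] apex_neq_D[OF 2] apex_class_alternative[OF xt t D copy z(1-4) y z(5)]])
    next
      case 3
      then have z: "a \<noteq> 0" "b \<noteq> 0" "c \<noteq> 0" "K = mirror_class a b c"
        unfolding mirrors_def by blast+
      show ?thesis
        by (rule finish[OF UnI2[OF 3] mirror_neq_D[OF 3] mirror_class_alternative[OF xt t D copy z(1-3) y z(4)]])
    qed
  qed
  then show ?thesis unfolding A_def B_def .
qed

section \<open>Distances in the interchange graph\<close>

text \<open>
  Transitivity makes the out-neighbourhoods shrink along arcs except for the opposite player,
  so at a player \<open>v\<close> of maximal out-degree the out-neighbours are the negatives of the
  in-neighbours, i.e. \<open>v\<close> and \<open>- v\<close> have the same out-neighbours. The same then holds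
  for every in-neighbour \<open>p\<close> of \<open>v\<close>, which forces an arc back from \<open>v\<close> to \<open>p\<close>.
\<close>

lemma no_transitive_balanced_arcs:
  fixes A :: "'a::group_add \<Rightarrow> 'a \<Rightarrow> bool"
  assumes "finite S" and in_S: "\<And>u v. A u v \<Longrightarrow> u \<in> S \<and> v \<in> S"
    and asym: "\<And>u v. A u v \<Longrightarrow> \<not> A v u"
    and mirror: "\<And>u v. A u v \<Longrightarrow> A (- v) (- u)"
    and balanced: "\<And>u. card {v. A u v} = card {v. A v u}"
    and trans: "\<And>u v t. A u v \<Longrightarrow> A v t \<Longrightarrow> t \<noteq> - u \<Longrightarrow> A u t"
  shows "\<not> A u v"
proof
  assume "A u v"
  define N where "N v = card {t. A v t}" for v
  have fin_out: "finite {t. A v t}" for v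
    by (rule finite_subset[OF _ \<open>finite S\<close>]) (use in_S in blast)
  have fin_in: "finite {t. A t v}" for v
    by (rule finite_subset[OF _ \<open>finite S\<close>]) (use in_S in blast)
  have "S \<noteq> {}" using in_S \<open>A u v\<close> by blast
  define M where "M = Max (N ` S)"
  have le: "N t \<le> M" if "t \<in> S" for t
    unfolding M_def using that \<open>finite S\<close> by simp
  obtain m where m: "m \<in> S" "N m = M"
    using Max_in[of "N ` S"] \<open>finite S\<close> \<open>S \<noteq> {}\<close> unfolding M_def by (metis (no_types) finite_imageI imageE image_is_empty)
  have rev: "A v (- u)" and up: "N u = M" if "A u v" "N v = M" for u v
  proof -
    have uS: "u \<in> S" using in_S that by blast
    show *: "A v (- u)"
    proof (rule ccontr)
      assume "\<not> A v (- u)"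
      \<comment> \<open>The exceptional case \<open>t = - u\<close> of transitivity does not occur
        here, so every out-neighbour of \<open>v\<close> is one of \<open>u\<close>, and
        \<open>u\<close> has \<open>v\<close> in addition.\<close>
      then have "{t. A v t} \<subset> {t. A u t}"
        using trans[OF \<open>A u v\<close>] asym \<open>A u v\<close> by blast
      then have "N v < N u" unfolding N_def by (rule psubset_card_mono[OF fin_out])
      then show False using le[OF uS] that by simp
    qed
    \<comment> \<open>Only \<open>- u\<close> can be missing from the out-neighbours of
      \<open>u\<close>, but \<open>v\<close> is gained, so the maximum passes from \<open>v\<close>
      to \<open>u\<close>.\<close>
    have "{t. A v t} - {- u} \<subseteq> {t. A u t} - {v}"
      using trans[OF \<open>A u v\<close>] asym by blast
    then have "card ({t. A v t} - {- u}) \<le> card ({t. A u t} - {v})"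
      by (rule card_mono[rotated]) (simp add: fin_out)
    then have "N v - 1 \<le> N u - 1"
      using * \<open>A u v\<close> by (simp add: N_def)
    moreover have "N u > 0" unfolding N_def using \<open>A u v\<close> fin_out by (auto simp: card_gt_0_iff)
    ultimately have "N v \<le> N u" by linarith
    then show "N u = M" using le[OF uS] that by simp
  qed
  have sym: "A v t \<longleftrightarrow> A (- v) t" if "N v = M" for v t
  proof -
    \<comment> \<open>Balance makes the negated in-neighbours as numerous as the out-neighbours
      among which they lie, so the two sets agree.\<close>
    have "uminus ` {u. A u v} = {t. A v t}"
    proof (rule card_subset_eq[OF fin_out])
      show "uminus ` {u. A u v} \<subseteq> {t. A v t}" using rev that by blast
      show "card (uminus ` {u. A u v}) = card {t. A v t}"
        using balanced[of v] by (subst card_image) (auto simp: inj_on_def)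
    qed
    then have "A v t \<longleftrightarrow> A (- t) v" by (metis (mono_tags, lifting) image_iff mem_Collect_eq minus_minus)
    also have "\<dots> \<longleftrightarrow> A (- v) t" using mirror[of "- t" v] mirror[of "- v" t] by auto
    finally show ?thesis .
  qed
  have "M > 0"
  proof -
    have "N u > 0" unfolding N_def using \<open>A u v\<close> fin_out by (auto simp: card_gt_0_iff)
    then show ?thesis using le[of u] in_S \<open>A u v\<close> by fastforce
  qed
  then have "card {u. A u m} > 0" using m balanced[of m] by (simp add: N_def)
  then have "{u. A u m} \<noteq> {}" by (metis card.empty less_irrefl)
  then obtain p where p: "A p m" by blast
  \<comment> \<open>\<open>p\<close> has maximal out-degree too, so the symmetry applies first at
    \<open>p\<close> and then, after mirroring, at \<open>m\<close>.\<close>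
  have "A (- p) m" using sym up p m by blast
  then have "A (- m) p" using mirror[of "- p" m] by simp
  then have "A m p" using sym m by blast
  then show False using asym p by blast
qed

section \<open>Games on which two tournaments differ\<close>

definition diff_games :: "tournament \<Rightarrow> tournament \<Rightarrow> edge set" where
  "diff_games w w' = {e. w e \<noteq> w' e}"

text \<open>Arcs carry the orientation in \<open>w\<close>; in \<open>w'\<close> they are reversed.
  Each differing game yields two arcs, which are mirror images of each other.\<close>

definition diff_arc :: "coxeter_type \<Rightarrow> tournament \<Rightarrow> tournament \<Rightarrow> int \<Rightarrow> int \<Rightarrow> bool" where
  "diff_arc \<Phi> w w' u v \<longleftrightarrow> u \<in> players \<Phi> \<and> v \<in> players \<Phi> \<and> \<bar>u\<bar> \<noteq> \<bar>v\<bar> \<and>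
     game u v \<in> diff_games w w' \<and> beats w u v"

lemma diff_games_subset_edges:
  assumes "w \<in> tournaments \<Phi>" "w' \<in> tournaments \<Phi>"
  shows "diff_games w w' \<subseteq> edges \<Phi>"
  using assms unfolding diff_games_def tournaments_def PiE_iff extensional_def by fastforce

lemma diff_games_flip:
  assumes "w \<in> tournaments \<Phi>" "w' \<in> tournaments \<Phi>" "X \<subseteq> edges \<Phi>"
  shows "diff_games (flip w X) w' = (diff_games w w' - X) \<union> (X - diff_games w w')"
proof -
  have "flip w X e \<noteq> w' e \<longleftrightarrow> (w e \<noteq> w' e) \<noteq> (e \<in> X)" for e
  proof (cases "e \<in> edges \<Phi>")
    case True
    then have "w e \<in> {0, 1}" "w' e \<in> {0, 1}" using tournament_outcome assms by blast+
    then show ?thesis by (auto simp: flip_def)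
  next
    case False
    then show ?thesis using assms(3) by (auto simp: flip_def)
  qed
  then show ?thesis unfolding diff_games_def by blast
qed

lemma game_in_diff_iff:
  assumes "w \<in> tournaments \<Phi>" "w' \<in> tournaments \<Phi>" "u \<in> players \<Phi>" "v \<in> players \<Phi>" "\<bar>u\<bar> \<noteq> \<bar>v\<bar>"
  shows "game u v \<in> diff_games w w' \<longleftrightarrow> beats w u v \<noteq> beats w' u v"
proof -
  have "game u v \<in> edges \<Phi>" using assms game_in_edges by blast
  then have "w (game u v) \<in> {0, 1}" "w' (game u v) \<in> {0, 1}" using tournament_outcome assms(1,2) by blast+
  then show ?thesis unfolding diff_games_def beats_def by auto
qed

lemma diff_arc_uminus: "diff_arc \<Phi> w w' u v \<Longrightarrow> diff_arc \<Phi> w w' (- v) (- u)"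
  using beats_uminus[of u v w] game_uminus[of v u] game_commute[of u v]
  unfolding diff_arc_def players_uminus abs_minus_cancel by metis

lemma diff_arc_asym: "diff_arc \<Phi> w w' u v \<Longrightarrow> \<not> diff_arc \<Phi> w w' v u"
  using beats_commute unfolding diff_arc_def by blast

text \<open>The two scores agree in the coordinate of \<open>u\<close>. Only games of
  \<open>u\<close> have a nonzero entry there, and a differing game contributes the sign of
  \<open>u\<close> for an out-arc and its negative for an in-arc.\<close>

lemma diff_arc_balanced_nonzero:
  assumes w: "w \<in> IntGr_verts \<Phi> s" "w' \<in> IntGr_verts \<Phi> s" and u: "u \<in> players \<Phi>" "u \<noteq> 0"
  shows "card {v. diff_arc \<Phi> w w' u v} = card {v. diff_arc \<Phi> w w' v u}"
proof -
  have wt: "w \<in> tournaments \<Phi>" "w' \<in> tournaments \<Phi>" using w by (auto simp: IntGr_verts_def)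
  define k where "k = nat \<bar>u\<bar>"
  define V where "V = {v \<in> players \<Phi>. \<bar>u\<bar> \<noteq> \<bar>v\<bar>}"
  define g where "g e = (real (w e) - 1 / 2) * edge_vec e k - (real (w' e) - 1 / 2) * edge_vec e k" for e
  have finV: "finite V" unfolding V_def by simp
  have "score \<Phi> w k - score \<Phi> w' k = sum g (edges \<Phi>)"
    unfolding g_def score_def score_on_def by (simp add: sum_subtractf)
  moreover have "score \<Phi> w k = score \<Phi> w' k" using w by (simp add: IntGr_verts_def)
  ultimately have "sum g (edges \<Phi>) = 0" by simp
  moreover have "sum g (edges \<Phi>) = sum g (game u ` V)"
  proof (rule sum.mono_neutral_right)
    show "game u ` V \<subseteq> edges \<Phi>" unfolding V_def using u game_in_edges by blast
    show "\<forall>e \<in> edges \<Phi> - game u ` V. g e = 0"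
    proof
      fix e assume e: "e \<in> edges \<Phi> - game u ` V"
      then obtain p q where pq: "e = game p q" "p \<in> players \<Phi>" "q \<in> players \<Phi>" "\<bar>p\<bar> \<noteq> \<bar>q\<bar>"
        unfolding edges_eq by blast
      have no: "\<bar>u\<bar> \<noteq> \<bar>r\<bar>" if "e = game r t" "r \<in> players \<Phi>" "t \<in> players \<Phi>" "\<bar>r\<bar> \<noteq> \<bar>t\<bar>" for r t
      proof
        assume "\<bar>u\<bar> = \<bar>r\<bar>"
        then consider "r = u" | "r = - u" by linarith
        then show False
        proof cases
          case 1
          then show False using e that unfolding V_def by blast
        next
          case 2
          then have "e = game u (- t)" using that(1) game_uminus[of u "- t"] by simp
          moreover have "- t \<in> V" using that 2 unfolding V_def by simp
          ultimately show False using e by blast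
        qed
      qed
      have up: "\<bar>u\<bar> \<noteq> \<bar>p\<bar>" using no pq by blast
      have uq: "\<bar>u\<bar> \<noteq> \<bar>q\<bar>" using no[of q p] pq game_commute by metis
      \<comment> \<open>The constant outcome \<open>1\<close> has the nonzero coefficient 1/2, so
        \<open>game_term_eq\<close> gives the vector entry itself.\<close>
      have "edge_vec e k = 0"
        using game_term_eq[OF pq(4), of "\<lambda>_. 1" k] player_vec_other[OF up] player_vec_other[OF uq]
        unfolding pq(1) k_def by simp
      then show "g e = 0" unfolding g_def by simp
    qed
  qed simp
  moreover have "sum g (game u ` V) = (\<Sum>v\<in>V. g (game u v))"
  proof -
    have "inj_on (game u) V"
    proof (rule inj_onI)
      fix v v' assume "v \<in> V" "v' \<in> V" and eq: "game u v = game u v'"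
      then have "\<bar>u\<bar> \<noteq> \<bar>v\<bar>" "\<bar>u\<bar> \<noteq> \<bar>v'\<bar>" unfolding V_def by blast+
      from game_eq_iff[OF this] eq this u(2) show "v = v'" by auto
    qed
    then show ?thesis by (simp add: sum.reindex)
  qed
  moreover have "g (game u v) =
      real_of_int (sgn u) * (of_bool (diff_arc \<Phi> w w' u v) - of_bool (diff_arc \<Phi> w w' v u))" if "v \<in> V" for v
  proof -
    have v: "v \<in> players \<Phi>" "\<bar>u\<bar> \<noteq> \<bar>v\<bar>" using that unfolding V_def by auto
    have e: "game u v \<in> edges \<Phi>" using u v game_in_edges by blast
    have out: "w (game u v) \<in> {0, 1}" "w' (game u v) \<in> {0, 1}" using tournament_outcome[OF _ e] wt by blast+
    have "g (game u v) = ((if beats w u v then 1 / 2 else - 1 / 2) - (if beats w' u v then 1 / 2 else - 1 / 2)) * real_of_int (sgn u)"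
      unfolding g_def game_term_eq[where w = w, OF v(2) out(1)] game_term_eq[where w = w', OF v(2) out(2)]
        k_def player_vec_self player_vec_other[OF v(2)]
      by (simp add: algebra_simps)
    moreover have "diff_arc \<Phi> w w' u v \<longleftrightarrow> beats w u v \<and> \<not> beats w' u v"
      using game_in_diff_iff[OF wt u(1) v] u v unfolding diff_arc_def by blast
    moreover have "diff_arc \<Phi> w w' v u \<longleftrightarrow> \<not> beats w u v \<and> beats w' u v"
      using game_in_diff_iff[OF wt u(1) v] u v beats_commute[OF v(2)] not_sym[OF v(2)]
      unfolding diff_arc_def game_commute[of v u] by blast
    ultimately show ?thesis by (simp split: if_splits)
  qed
  ultimately have "real_of_int (sgn u) * (\<Sum>v\<in>V. of_bool (diff_arc \<Phi> w w' u v) - of_bool (diff_arc \<Phi> w w' v u)) = 0"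
    by (simp add: sum_distrib_left)
  then have "(\<Sum>v\<in>V. of_bool (diff_arc \<Phi> w w' u v)) = (\<Sum>v\<in>V. of_bool (diff_arc \<Phi> w w' v u) :: real)"
    using u(2) by (simp add: sum_subtractf sgn_if split: if_splits)
  then have "real (card (V \<inter> {v. diff_arc \<Phi> w w' u v})) = real (card (V \<inter> {v. diff_arc \<Phi> w w' v u}))"
    using finV by (simp add: of_bool_def sum.If_cases)
  moreover have "V \<inter> {v. diff_arc \<Phi> w w' u v} = {v. diff_arc \<Phi> w w' u v}"
    "V \<inter> {v. diff_arc \<Phi> w w' v u} = {v. diff_arc \<Phi> w w' v u}"
    unfolding V_def diff_arc_def by auto
  ultimately show ?thesis by simp
qed

lemma diff_arc_balanced:
  assumes w: "w \<in> IntGr_verts \<Phi> s" "w' \<in> IntGr_verts \<Phi> s"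
  shows "card {v. diff_arc \<Phi> w w' u v} = card {v. diff_arc \<Phi> w w' v u}"
proof -
  consider "u \<notin> players \<Phi>" | "u \<in> players \<Phi>" "u \<noteq> 0" | "u = 0" by blast
  then show ?thesis
  proof cases
    case 1
    then show ?thesis unfolding diff_arc_def by simp
  next
    case 2
    then show ?thesis using diff_arc_balanced_nonzero[OF w] by blast
  next
    case 3
    \<comment> \<open>No score coordinate belongs to player \<open>0\<close>; there negation
      interchanges in- and out-neighbours.\<close>
    have "{v. diff_arc \<Phi> w w' 0 v} = uminus ` {v. diff_arc \<Phi> w w' v 0}"
    proof (intro equalityI subsetI)
      fix v assume "v \<in> {v. diff_arc \<Phi> w w' 0 v}"
      then have "diff_arc \<Phi> w w' (- v) 0" using diff_arc_uminus[of \<Phi> w w' 0 v] by simp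
      then show "v \<in> uminus ` {v. diff_arc \<Phi> w w' v 0}"
        by (intro image_eqI[of _ _ "- v"]) auto
    next
      fix v assume "v \<in> uminus ` {v. diff_arc \<Phi> w w' v 0}"
      then show "v \<in> {v. diff_arc \<Phi> w w' 0 v}" using diff_arc_uminus[of \<Phi> w w' _ 0] by force
    qed
    then show ?thesis unfolding 3 by (simp add: card_image)
  qed
qed

text \<open>Balance rules out transitivity, so there are arcs from \<open>u\<close> to
  \<open>v\<close> and from \<open>v\<close> to \<open>t\<close> but none from \<open>u\<close> to
  \<open>t\<close>. Either \<open>t\<close> beats \<open>u\<close> in \<open>w\<close>, which closes
  a cycle there, or the third game agrees in both tournaments and closes the reversed cycle in
  \<open>w'\<close>.\<close>

lemma diff_games_reducible:
  assumes w: "w \<in> IntGr_verts \<Phi> s" "w' \<in> IntGr_verts \<Phi> s" and "w \<noteq> w'"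
  obtains X where "generator_copy \<Phi> w X \<or> generator_copy \<Phi> w' X"
    "card ((diff_games w w' - X) \<union> (X - diff_games w w')) < card (diff_games w w')"
proof -
  have wt: "w \<in> tournaments \<Phi>" "w' \<in> tournaments \<Phi>" using w by (auto simp: IntGr_verts_def)
  let ?A = "diff_arc \<Phi> w w'"
  let ?D = "diff_games w w'"
  have finD: "finite ?D" by (rule finite_subset[OF diff_games_subset_edges[OF wt] finite_edges])
  have "\<exists>u v. ?A u v"
  proof -
    obtain e where e: "e \<in> ?D" using \<open>w \<noteq> w'\<close> unfolding diff_games_def by auto
    then obtain u v where "e = game u v" "u \<in> players \<Phi>" "v \<in> players \<Phi>" "\<bar>u\<bar> \<noteq> \<bar>v\<bar>"
      using diff_games_subset_edges[OF wt] unfolding edges_eq by blast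
    then show ?thesis using e beats_commute[of u v w] game_commute[of u v] unfolding diff_arc_def by metis
  qed
  then have "\<exists>u v t. ?A u v \<and> ?A v t \<and> t \<noteq> - u \<and> \<not> ?A u t"
    using no_transitive_balanced_arcs[of "players \<Phi>" ?A, OF finite_players _ diff_arc_asym diff_arc_uminus
        diff_arc_balanced[OF w]]
    by (meson diff_arc_def)
  then obtain u v t where uvt: "?A u v" "?A v t" "t \<noteq> - u" "\<not> ?A u t" by blast
  have "t \<noteq> u" using uvt diff_arc_asym by blast
  then have tri: "triple \<Phi> u v t" using uvt unfolding triple_def diff_arc_def by (metis abs_eq_iff)
  note pl = tri[unfolded triple_def]
  let ?X = "trigon u v t"
  have uv: "game u v \<in> ?D" "beats w u v" "\<not> beats w' u v"
    using uvt(1) game_in_diff_iff[OF wt, of u v] unfolding diff_arc_def by blast+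
  have vt: "game v t \<in> ?D" "beats w v t" "\<not> beats w' v t"
    using uvt(2) game_in_diff_iff[OF wt, of v t] unfolding diff_arc_def by blast+
  have tu: "beats w t u \<or> (game t u \<notin> ?D \<and> \<not> beats w' t u)"
    using uvt(4) game_in_diff_iff[OF wt, of t u] beats_commute[of u t w] pl game_commute[of u t]
    unfolding diff_arc_def by metis
  have "generator_copy \<Phi> w ?X \<or> generator_copy \<Phi> w' ?X"
    using generator_copy_trigon_iff[OF wt(1) tri] generator_copy_trigon_iff[OF wt(2) tri] uv vt tu by blast
  moreover have "card ((?D - ?X) \<union> (?X - ?D)) < card ?D"
  proof -
    have ne: "game u v \<noteq> game v t" using trigon_games_distinct pl by blast
    \<comment> \<open>Two games leave the difference and at most one enters it.\<close>
    have "(?D - ?X) \<union> (?X - ?D) \<subseteq> insert (game t u) (?D - {game u v, game v t})"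
      using uv vt unfolding trigon_def by blast
    then have "card ((?D - ?X) \<union> (?X - ?D)) \<le> card (insert (game t u) (?D - {game u v, game v t}))"
      by (rule card_mono[rotated]) (simp add: finD)
    also have "\<dots> \<le> Suc (card (?D - {game u v, game v t}))"
      by (rule card_insert_le_m1) (simp_all)
    also have "card (?D - {game u v, game v t}) = card ?D - 2"
      using uv vt ne finD by (subst card_Diff_subset) auto
    also have "Suc (card ?D - 2) < card ?D"
    proof -
      have "card {game u v, game v t} \<le> card ?D" using uv vt finD by (intro card_mono) auto
      then show ?thesis using ne by simp
    qed
    finally show ?thesis .
  qed
  ultimately show ?thesis using that by blast
qed

text \<open>This stands for a path no longer than the number of differing games, phrased through
  test functions. With \<open>L = 0\<close> it expresses connectedness: functions constant along
  edges are constant.\<close>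

lemma lipschitz_diff_games:
  fixes f :: "tournament \<Rightarrow> real"
  assumes lip: "\<And>x y. x \<in> IntGr_verts \<Phi> s \<Longrightarrow> y \<in> IntGr_verts \<Phi> s \<Longrightarrow> IntGr_adj \<Phi> x y \<Longrightarrow> \<bar>f x - f y\<bar> \<le> L"
    and w: "w \<in> IntGr_verts \<Phi> s" "w' \<in> IntGr_verts \<Phi> s" and "0 \<le> L"
  shows "\<bar>f w - f w'\<bar> \<le> L * card (diff_games w w')"
  using w
proof (induction "card (diff_games w w')" arbitrary: w w' rule: less_induct)
  case less
  have sym: "diff_games p q = diff_games q p" for p q unfolding diff_games_def by auto
  show ?case
  proof (cases "w = w'")
    case True
    then show ?thesis using \<open>0 \<le> L\<close> by simp
  next
    case False
    have wt: "w \<in> tournaments \<Phi>" "w' \<in> tournaments \<Phi>" using less.prems by (auto simp: IntGr_verts_def)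
    obtain X where X: "generator_copy \<Phi> w X \<or> generator_copy \<Phi> w' X"
      and card: "card ((diff_games w w' - X) \<union> (X - diff_games w w')) < card (diff_games w w')"
      using diff_games_reducible[OF less.prems False] by blast
    have XE: "X \<subseteq> edges \<Phi>" using X generator_games_subset_edges unfolding generator_copy_def by blast
    have bound: "L * real m + L \<le> L * real n" if "m < n" for m n
    proof -
      have "L * (real m + 1) \<le> L * real n" using that \<open>0 \<le> L\<close> by (intro mult_left_mono) auto
      then show ?thesis by (simp add: algebra_simps)
    qed
    \<comment> \<open>The copy may lie in either tournament, so the path is shortened at either
      end.\<close>
    from X show ?thesis
    proof
      assume X: "generator_copy \<Phi> w X"
      have v: "flip w X \<in> IntGr_verts \<Phi> s" using flip_copy_in_verts[OF less.prems(1) X] .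
      have "\<bar>f w - f (flip w X)\<bar> \<le> L"
        using lip[OF less.prems(1) v] X unfolding IntGr_adj_def by blast
      moreover have c: "card (diff_games (flip w X) w') < card (diff_games w w')"
        using card diff_games_flip[OF wt XE] by simp
      ultimately show ?thesis
        using less.hyps[OF c v less.prems(2)] bound[OF c] by linarith
    next
      assume X: "generator_copy \<Phi> w' X"
      have v: "flip w' X \<in> IntGr_verts \<Phi> s" using flip_copy_in_verts[OF less.prems(2) X] .
      have "\<bar>f w' - f (flip w' X)\<bar> \<le> L"
        using lip[OF less.prems(2) v] X unfolding IntGr_adj_def by blast
      moreover have c: "card (diff_games w (flip w' X)) < card (diff_games w w')"
        using card diff_games_flip[OF wt(2,1) XE] sym by simp
      ultimately show ?thesis
        using less.hyps[OF c less.prems(1) v] bound[OF c] by linarith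
    qed
  qed
qed

text \<open>In the square grid, negative edges fit below the diagonal, positive ones above it and
  half edges on it.\<close>

lemma card_edges_le: "card (edges \<Phi>) \<le> cox_rank \<Phi> ^ 2"
proof -
  let ?n = "cox_rank \<Phi>"
  let ?f = "\<lambda>(i, j). if j < i then Neg i j else if i < j then Pos j i else Half i"
  have "edges \<Phi> \<subseteq> ?f ` ({1..?n} \<times> {1..?n})"
  proof
    fix e assume e: "e \<in> edges \<Phi>"
    show "e \<in> ?f ` ({1..?n} \<times> {1..?n})"
    proof (cases e)
      case (Neg i j)
      then show ?thesis using e by (intro image_eqI[of _ _ "(i, j)"]; cases \<Phi>; auto simp: signed_pairs_def)
    next
      case (Pos i j)
      then show ?thesis using e by (intro image_eqI[of _ _ "(j, i)"]; cases \<Phi>; auto simp: signed_pairs_def)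
    next
      case (Half i)
      then show ?thesis using e by (intro image_eqI[of _ _ "(i, i)"]; cases \<Phi>; auto simp: signed_pairs_def)
    qed
  qed
  then have "card (edges \<Phi>) \<le> card (?f ` ({1..?n} \<times> {1..?n}))" by (rule card_mono[rotated]) simp
  also have "\<dots> \<le> card ({1..?n} \<times> {1..?n})" by (rule card_image_le) simp
  finally show ?thesis by (simp add: card_cartesian_product power2_eq_square)
qed

section \<open>Lazy walks that contract Lipschitz constants\<close>

locale lazy_walk =
  fixes V :: "'a set" and adj :: "'a \<Rightarrow> 'a \<Rightarrow> bool" and d :: nat
  assumes finite_V: "finite V" and V_nonempty: "V \<noteq> {}"
    and adj_sym: "x \<in> V \<Longrightarrow> y \<in> V \<Longrightarrow> adj x y \<longleftrightarrow> adj y x"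
    and regular: "x \<in> V \<Longrightarrow> card (nbrs V adj x) = d"
    and d_pos: "0 < d"
begin

text \<open>The transition operator of the walk, acting on functions.\<close>

definition step_fun :: "('a \<Rightarrow> real) \<Rightarrow> 'a \<Rightarrow> real" where
  "step_fun f x = f x / 2 + (\<Sum>y\<in>nbrs V adj x. f y) / (2 * real d)"

definition mean :: "'a pmf \<Rightarrow> ('a \<Rightarrow> real) \<Rightarrow> real" where
  "mean p f = (\<Sum>y\<in>V. pmf p y * f y)"

lemma nbrs_subset: "nbrs V adj x \<subseteq> V" by (auto simp: nbrs_def)

lemma finite_nbrs: "finite (nbrs V adj x)" using finite_subset[OF nbrs_subset finite_V] .

lemma nbrs_nonempty: "x \<in> V \<Longrightarrow> nbrs V adj x \<noteq> {}" using regular d_pos by fastforce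

lemma pmf_lazy_step:
  assumes "x \<in> V"
  shows "pmf (lazy_step V adj x) y = indicator {x} y / 2 + indicator (nbrs V adj x) y / (2 * real d)"
  using nbrs_nonempty[OF assms] finite_nbrs[of x] regular[OF assms]
  by (simp add: lazy_step_def pmf_bind indicator_def)

lemma set_lazy_step: "x \<in> V \<Longrightarrow> set_pmf (lazy_step V adj x) \<subseteq> V"
  using nbrs_nonempty finite_nbrs[of x] nbrs_subset[of x]
  by (auto simp: lazy_step_def split: if_splits)

lemma pmf_bind_sum:
  assumes "set_pmf p \<subseteq> V"
  shows "pmf (bind_pmf p Q) y = (\<Sum>x\<in>V. pmf p x * pmf (Q x) y)"
  unfolding pmf_bind using assms finite_V
  by (subst integral_measure_pmf[of V]) (auto simp: mult.commute)

lemma mean_lazy_step: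
  assumes "x \<in> V"
  shows "mean (lazy_step V adj x) f = step_fun f x"
proof -
  have "mean (lazy_step V adj x) f =
    (\<Sum>y\<in>V. indicator {x} y * f y) / 2 + (\<Sum>y\<in>V. indicator (nbrs V adj x) y * f y) / (2 * real d)"
    unfolding mean_def pmf_lazy_step[OF assms]
    by (simp add: sum.distrib algebra_simps sum_divide_distrib)
  also have "(\<Sum>y\<in>V. indicator {x} y * f y) = f x"
    using assms finite_V by (simp add: indicator_def if_distrib if_distribR cong: if_cong)
  also have "(\<Sum>y\<in>V. indicator (nbrs V adj x) y * f y) = (\<Sum>y\<in>nbrs V adj x. f y)"
    using finite_V nbrs_subset[of x]
    by (intro sum.mono_neutral_cong_right) (auto simp: indicator_def)
  finally show ?thesis by (simp add: step_fun_def)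
qed

text \<open>Duality: a step of the walk moves from the distribution to the test function.\<close>

lemma mean_bind:
  assumes "set_pmf p \<subseteq> V"
  shows "mean (bind_pmf p (lazy_step V adj)) f = mean p (step_fun f)"
proof -
  have "mean (bind_pmf p (lazy_step V adj)) f = (\<Sum>y\<in>V. \<Sum>x\<in>V. pmf p x * (pmf (lazy_step V adj x) y * f y))"
    unfolding mean_def pmf_bind_sum[OF assms] by (simp add: sum_distrib_right mult.assoc)
  also have "\<dots> = (\<Sum>x\<in>V. pmf p x * mean (lazy_step V adj x) f)"
    unfolding mean_def by (subst sum.swap) (simp add: sum_distrib_left)
  also have "\<dots> = mean p (step_fun f)"
    unfolding mean_def[of p] using mean_lazy_step by (intro sum.cong) auto
  finally show ?thesis .
qed

lemma mean_return: "x \<in> V \<Longrightarrow> mean (return_pmf x) f = f x"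
  using finite_V by (simp add: mean_def indicator_def if_distrib if_distribR cong: if_cong)

lemma set_step_dist: "x \<in> V \<Longrightarrow> set_pmf (step_dist (lazy_step V adj) t x) \<subseteq> V"
proof (induction t)
  case (Suc t)
  then show ?case using set_lazy_step by fastforce
qed simp

text \<open>The kernel is symmetric, so its columns sum to one as its rows do.\<close>

lemma uniform_stationary: "bind_pmf (pmf_of_set V) (lazy_step V adj) = pmf_of_set V"
proof (rule pmf_eqI)
  fix y
  have setV: "set_pmf (pmf_of_set V) \<subseteq> V" using finite_V V_nonempty by simp
  have "pmf (bind_pmf (pmf_of_set V) (lazy_step V adj)) y = (\<Sum>x\<in>V. pmf (lazy_step V adj x) y) / card V"
    unfolding pmf_bind_sum[OF setV] using finite_V V_nonempty
    by (simp add: sum_divide_distrib)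
  also have "\<dots> = pmf (pmf_of_set V) y"
  proof (cases "y \<in> V")
    case True
    have "(\<Sum>x\<in>V. pmf (lazy_step V adj x) y) = (\<Sum>x\<in>V. pmf (lazy_step V adj y) x)"
      using adj_sym True by (intro sum.cong) (auto simp: pmf_lazy_step indicator_def nbrs_def)
    also have "\<dots> = 1" by (rule sum_pmf_eq_1[OF finite_V set_lazy_step[OF True]])
    finally show ?thesis using True finite_V V_nonempty by simp
  next
    case False
    then have "pmf (lazy_step V adj x) y = 0" if "x \<in> V" for x
      using set_lazy_step[OF that] by (auto simp: set_pmf_iff)
    then show ?thesis using False finite_V V_nonempty by simp
  qed
  finally show "pmf (bind_pmf (pmf_of_set V) (lazy_step V adj)) y = pmf (pmf_of_set V) y" .
qed

definition lipschitz :: "real \<Rightarrow> ('a \<Rightarrow> real) \<Rightarrow> bool" where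
  "lipschitz L f \<longleftrightarrow> (\<forall>x\<in>V. \<forall>y\<in>V. adj x y \<longrightarrow> \<bar>f x - f y\<bar> \<le> L)"

end

text \<open>Dual form of path coupling: \<open>M\<close> bounds the diameter, and the coupling of
  adjacent vertices is replaced by its effect on Lipschitz functions.\<close>

locale contracting_lazy_walk = lazy_walk +
  fixes M :: real
  assumes diameter: "0 \<le> L \<Longrightarrow> lipschitz L f \<Longrightarrow> x \<in> V \<Longrightarrow> y \<in> V \<Longrightarrow> \<bar>f x - f y\<bar> \<le> L * M"
    and contraction: "lipschitz L f \<Longrightarrow> lipschitz ((1 - 1 / real d) * L) (step_fun f)"
begin

lemma rate_nonneg: "0 \<le> 1 - 1 / real d"
  using d_pos by (simp add: field_simps)

text \<open>Each step is moved onto \<open>f\<close> and shrinks its Lipschitz constant, while \<pi>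
  stays fixed. At the end the diameter bounds the oscillation of the resulting function.\<close>

lemma mean_step_dist_stationary:
  assumes "0 \<le> L" "lipschitz L f" "x \<in> V" "set_pmf \<pi> \<subseteq> V" "bind_pmf \<pi> (lazy_step V adj) = \<pi>"
  shows "\<bar>mean (step_dist (lazy_step V adj) t x) f - mean \<pi> f\<bar> \<le> (1 - 1 / real d) ^ t * L * M"
  using assms(1,2)
proof (induction t arbitrary: f L)
  case 0
  have one: "(\<Sum>y\<in>V. pmf \<pi> y) = 1" by (rule sum_pmf_eq_1[OF finite_V assms(4)])
  have "mean (step_dist (lazy_step V adj) 0 x) f - mean \<pi> f = (\<Sum>y\<in>V. pmf \<pi> y * (f x - f y))"
    using one by (simp add: mean_return assms(3) mean_def[of \<pi>] right_diff_distrib sum_subtractf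
        sum_distrib_right[symmetric])
  also have "\<bar>\<dots>\<bar> \<le> (\<Sum>y\<in>V. \<bar>pmf \<pi> y * (f x - f y)\<bar>)" by (rule sum_abs)
  also have "\<dots> \<le> (\<Sum>y\<in>V. pmf \<pi> y * (L * M))"
    using diameter[OF 0 assms(3)] by (intro sum_mono) (auto simp: abs_mult intro!: mult_left_mono)
  also have "\<dots> = L * M" using one by (simp add: sum_distrib_right[symmetric])
  finally show ?case by simp
next
  case (Suc t)
  have "mean (step_dist (lazy_step V adj) (Suc t) x) f - mean \<pi> f =
     mean (step_dist (lazy_step V adj) t x) (step_fun f) - mean \<pi> (step_fun f)"
    using mean_bind[OF set_step_dist[OF assms(3)], of t f] mean_bind[OF assms(4), of f] assms(5) by simp
  also have "\<bar>\<dots>\<bar> \<le> (1 - 1 / real d) ^ t * ((1 - 1 / real d) * L) * M"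
    using Suc.prems rate_nonneg by (intro Suc.IH contraction) auto
  finally show ?case by (simp add: mult_ac)
qed

lemma step_dist_stationary:
  assumes "x \<in> V" "set_pmf \<pi> \<subseteq> V" "bind_pmf \<pi> (lazy_step V adj) = \<pi>"
  shows "1 / 2 * (\<Sum>y\<in>V. \<bar>pmf (step_dist (lazy_step V adj) t x) y - pmf \<pi> y\<bar>) \<le> (1 - 1 / real d) ^ t * M"
proof -
  \<comment> \<open>This sign function turns the difference of means into the full sum of absolute
    values. Its values lie between -1 and 1, hence the constant 2, which cancels the factor
    1/2.\<close>
  define f where "f y = sgn (pmf (step_dist (lazy_step V adj) t x) y - pmf \<pi> y)" for y
  have "lipschitz 2 f" unfolding lipschitz_def f_def by (auto simp: sgn_if)
  then have "\<bar>mean (step_dist (lazy_step V adj) t x) f - mean \<pi> f\<bar> \<le> (1 - 1 / real d) ^ t * 2 * M"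
    using assms by (intro mean_step_dist_stationary) auto
  moreover have "mean (step_dist (lazy_step V adj) t x) f - mean \<pi> f =
      (\<Sum>y\<in>V. \<bar>pmf (step_dist (lazy_step V adj) t x) y - pmf \<pi> y\<bar>)"
    unfolding mean_def sum_subtractf[symmetric] left_diff_distrib[symmetric] f_def
    by (intro sum.cong) (auto simp: sgn_if)
  ultimately show ?thesis by simp
qed

text \<open>Each stationary distribution is the limit of the same walk from a fixed
  \<open>x\<close>. Uniqueness is what determines the description in
  \<open>stationary\<close>.\<close>

lemma stationary_unique:
  assumes "set_pmf \<pi> \<subseteq> V" "bind_pmf \<pi> (lazy_step V adj) = \<pi>"
    and "set_pmf \<pi>' \<subseteq> V" "bind_pmf \<pi>' (lazy_step V adj) = \<pi>'"
  shows "\<pi> = \<pi>'"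
proof (rule pmf_eqI)
  fix y
  obtain x where x: "x \<in> V" using V_nonempty by blast
  have lim: "(\<lambda>t. pmf (step_dist (lazy_step V adj) t x) y) \<longlonglongrightarrow> pmf \<rho> y"
    if "y \<in> V" "set_pmf \<rho> \<subseteq> V" "bind_pmf \<rho> (lazy_step V adj) = \<rho>" for \<rho>
  proof (rule Lim_null_comparison[THEN LIM_zero_cancel])
    have "\<bar>pmf (step_dist (lazy_step V adj) t x) y - pmf \<rho> y\<bar> \<le> 2 * ((1 - 1 / real d) ^ t * M)" for t
    proof -
      have "\<bar>pmf (step_dist (lazy_step V adj) t x) y - pmf \<rho> y\<bar>
          \<le> (\<Sum>y\<in>V. \<bar>pmf (step_dist (lazy_step V adj) t x) y - pmf \<rho> y\<bar>)"
        using finite_V \<open>y \<in> V\<close> by (intro member_le_sum) auto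
      then show ?thesis using step_dist_stationary[OF x that(2,3), of t] by linarith
    qed
    then show "\<forall>\<^sub>F t in sequentially. norm (pmf (step_dist (lazy_step V adj) t x) y - pmf \<rho> y)
        \<le> 2 * ((1 - 1 / real d) ^ t * M)" by simp
    have "(\<lambda>t. (1 - 1 / real d) ^ t) \<longlonglongrightarrow> 0"
      using rate_nonneg d_pos by (intro LIMSEQ_realpow_zero) auto
    then have "(\<lambda>t. 2 * ((1 - 1 / real d) ^ t * M)) \<longlonglongrightarrow> 2 * (0 * M)"
      by (rule tendsto_mult[OF tendsto_const tendsto_mult[OF _ tendsto_const]])
    then show "(\<lambda>t. 2 * ((1 - 1 / real d) ^ t * M)) \<longlonglongrightarrow> 0" by simp
  qed
  show "pmf \<pi> y = pmf \<pi>' y"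
  proof (cases "y \<in> V")
    case True
    then show ?thesis using LIMSEQ_unique[OF lim lim] assms by blast
  next
    case False
    then show ?thesis using assms by (metis pmf_eq_0_set_pmf subsetD)
  qed
qed

lemma mixing_distance_le: "mixing_distance V (lazy_step V adj) t \<le> (1 - 1 / real d) ^ t * M"
proof -
  have "set_pmf (stationary V (lazy_step V adj)) \<subseteq> V \<and>
      bind_pmf (stationary V (lazy_step V adj)) (lazy_step V adj) = stationary V (lazy_step V adj)"
    unfolding stationary_def
  proof (rule theI)
    show "set_pmf (pmf_of_set V) \<subseteq> V \<and> bind_pmf (pmf_of_set V) (lazy_step V adj) = pmf_of_set V"
      using uniform_stationary finite_V V_nonempty by simp
  next
    fix \<pi> assume "set_pmf \<pi> \<subseteq> V \<and> bind_pmf \<pi> (lazy_step V adj) = \<pi>"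
    then show "\<pi> = pmf_of_set V"
      using stationary_unique uniform_stationary finite_V V_nonempty by simp
  qed
  then show ?thesis
    unfolding mixing_distance_def using finite_V V_nonempty step_dist_stationary by simp
qed

end

lemma mixing_time_le: "mixing_distance V P t \<le> 1 / 4 \<Longrightarrow> mixing_time V P \<le> enat t"
  unfolding mixing_time_def by (rule INF_lower) simp

section \<open>Mixing of the interchange walk\<close>

lemma card_copies_adjacent:
  assumes x: "x \<in> IntGr_verts \<Phi> s" and copy: "generator_copy \<Phi> x D"
  shows "card {X. generator_copy \<Phi> (flip x D) X} = card {X. generator_copy \<Phi> x X}"
proof -
  obtain \<phi> where "bij_betw \<phi> ({X. generator_copy \<Phi> x X} - {D}) ({X. generator_copy \<Phi> (flip x D) X} - {D})"
    using interchange_bijection[OF x copy refl] by blast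
  then have same: "card ({X. generator_copy \<Phi> x X} - {D}) = card ({X. generator_copy \<Phi> (flip x D) X} - {D})"
    by (rule bij_betw_same_card)
  have Suc_card: "card {X. generator_copy \<Phi> w X} = Suc (card ({X. generator_copy \<Phi> w X} - {D}))"
    if "generator_copy \<Phi> w D" for w
    using that finite_generator_copies by (metis (no_types, lifting) card.remove mem_Collect_eq)
  show "card {X. generator_copy \<Phi> (flip x D) X} = card {X. generator_copy \<Phi> x X}"
    unfolding Suc_card[OF copy] Suc_card[OF flip_copy_flip(2)[OF x copy]] same ..
qed

lemma card_copies_eq:
  assumes "x \<in> IntGr_verts \<Phi> s" "y \<in> IntGr_verts \<Phi> s"
  shows "card {X. generator_copy \<Phi> x X} = card {X. generator_copy \<Phi> y X}"
proof -
  \<comment> \<open>Lipschitz constant \<open>0\<close> turns equality along edges into equality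
    everywhere.\<close>
  have "\<bar>real (card {X. generator_copy \<Phi> x X}) - real (card {X. generator_copy \<Phi> y X})\<bar>
      \<le> 0 * real (card (diff_games x y))"
  proof (rule lipschitz_diff_games[OF _ assms])
    fix x y assume "x \<in> IntGr_verts \<Phi> s" "y \<in> IntGr_verts \<Phi> s" "IntGr_adj \<Phi> x y"
    then show "\<bar>real (card {X. generator_copy \<Phi> x X}) - real (card {X. generator_copy \<Phi> y X})\<bar> \<le> 0"
      using card_copies_adjacent unfolding IntGr_adj_def by auto
  qed simp
  then show ?thesis by simp
qed

lemma card_nbrs_IntGr:
  assumes "x \<in> IntGr_verts \<Phi> s"
  shows "card (nbrs (IntGr_verts \<Phi> s) (IntGr_adj \<Phi>) x) = card {X. generator_copy \<Phi> x X}"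
  unfolding nbrs_IntGr[OF assms] by (rule card_image[OF inj_on_flip_copies[OF assms]])

lemma IntGr_degree_eq:
  assumes "x \<in> IntGr_verts \<Phi> s"
  shows "IntGr_degree \<Phi> s = card {X. generator_copy \<Phi> x X}"
  unfolding IntGr_degree_def regular_degree_def
proof (rule the_equality)
  show "\<forall>y\<in>IntGr_verts \<Phi> s. card (nbrs (IntGr_verts \<Phi> s) (IntGr_adj \<Phi>) y) = card {X. generator_copy \<Phi> x X}"
    using card_nbrs_IntGr card_copies_eq[OF assms] by metis
next
  fix d assume "\<forall>y\<in>IntGr_verts \<Phi> s. card (nbrs (IntGr_verts \<Phi> s) (IntGr_adj \<Phi>) y) = d"
  then show "d = card {X. generator_copy \<Phi> x X}" using card_nbrs_IntGr assms by metis
qed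

lemma finite_IntGr_verts: "finite (IntGr_verts \<Phi> s)"
  by (rule finite_subset[of _ "tournaments \<Phi>"]) (auto simp: IntGr_verts_def tournaments_def intro!: finite_PiE)

lemma card_diff_games_le:
  assumes "x \<in> IntGr_verts \<Phi> s" "y \<in> IntGr_verts \<Phi> s"
  shows "real (card (diff_games x y)) \<le> real (cox_rank \<Phi>) ^ 2"
proof -
  have "card (diff_games x y) \<le> card (edges \<Phi>)"
    using assms diff_games_subset_edges[of x \<Phi> y] by (intro card_mono) (auto simp: IntGr_verts_def)
  also have "\<dots> \<le> cox_rank \<Phi> ^ 2" by (rule card_edges_le)
  finally show ?thesis by (metis of_nat_le_iff of_nat_power)
qed

text \<open>The vertices \<open>x\<close> and \<open>y\<close> are neighbours of each other, and
  \<open>interchange_bijection\<close> pairs their other neighbours along edges.\<close>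

lemma IntGr_contracting:
  assumes "IntGr_verts \<Phi> s \<noteq> {}" and pos: "0 < IntGr_degree \<Phi> s"
  shows "contracting_lazy_walk (IntGr_verts \<Phi> s) (IntGr_adj \<Phi>) (IntGr_degree \<Phi> s) (real (cox_rank \<Phi>) ^ 2)"
proof -
  let ?V = "IntGr_verts \<Phi> s" and ?d = "IntGr_degree \<Phi> s"
  interpret lazy_walk ?V "IntGr_adj \<Phi>" ?d
    by unfold_locales (use finite_IntGr_verts assms IntGr_adj_sym card_nbrs_IntGr IntGr_degree_eq in auto)
  have step: "step_fun f x = f x / 2 + (\<Sum>X | generator_copy \<Phi> x X. f (flip x X)) / (2 * real ?d)"
    if "x \<in> ?V" for f x
    unfolding step_fun_def nbrs_IntGr[OF that] by (simp add: sum.reindex[OF inj_on_flip_copies[OF that]])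
  show ?thesis
  proof
    fix L f x y assume L: "0 \<le> L" "lipschitz L f" and xy: "x \<in> ?V" "y \<in> ?V"
    have "\<bar>f x - f y\<bar> \<le> L * real (card (diff_games x y))"
      using L xy unfolding lipschitz_def by (intro lipschitz_diff_games) auto
    also have "\<dots> \<le> L * real (cox_rank \<Phi>) ^ 2"
      using card_diff_games_le[OF xy] L by (intro mult_left_mono) auto
    finally show "\<bar>f x - f y\<bar> \<le> L * real (cox_rank \<Phi>) ^ 2" .
  next
    fix L f assume L: "lipschitz L f"
    show "lipschitz ((1 - 1 / real ?d) * L) (step_fun f)"
      unfolding lipschitz_def
    proof (intro ballI impI)
      fix x y assume x: "x \<in> ?V" and y: "y \<in> ?V" and "IntGr_adj \<Phi> x y"
      then obtain D where copy: "generator_copy \<Phi> x D" and yD: "y = flip x D"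
        unfolding IntGr_adj_def by blast
      let ?A = "{X. generator_copy \<Phi> x X} - {D}" and ?B = "{X. generator_copy \<Phi> y X} - {D}"
      obtain \<phi> where bij: "bij_betw \<phi> ?A ?B"
        and adj: "\<And>X. X \<in> ?A \<Longrightarrow> IntGr_adj \<Phi> (flip x X) (flip y (\<phi> X))"
        using interchange_bijection[OF x copy yD] by blast
      note flip_back = flip_copy_flip[OF x copy, folded yD]
      have sx: "(\<Sum>X | generator_copy \<Phi> x X. f (flip x X)) = f y + (\<Sum>X\<in>?A. f (flip x X))"
        using copy yD finite_generator_copies by (subst sum.remove[of _ D]) auto
      have "(\<Sum>X | generator_copy \<Phi> y X. f (flip y X)) = f x + (\<Sum>X\<in>?B. f (flip y X))"
        using flip_back finite_generator_copies by (subst sum.remove[of _ D]) auto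
      also have "(\<Sum>X\<in>?B. f (flip y X)) = (\<Sum>X\<in>?A. f (flip y (\<phi> X)))"
        by (rule sum.reindex_bij_betw[OF bij, symmetric])
      finally have sy: "(\<Sum>X | generator_copy \<Phi> y X. f (flip y X)) = f x + (\<Sum>X\<in>?A. f (flip y (\<phi> X)))" .
      define R where "R = (\<Sum>X\<in>?A. f (flip x X) - f (flip y (\<phi> X)))"
      have "\<bar>R\<bar> \<le> (\<Sum>X\<in>?A. \<bar>f (flip x X) - f (flip y (\<phi> X))\<bar>)" unfolding R_def by (rule sum_abs)
      also have "\<dots> \<le> (\<Sum>X\<in>?A. L)"
      proof (rule sum_mono)
        fix X assume X: "X \<in> ?A"
        then have "\<phi> X \<in> ?B" using bij bij_betwE by blast
        then have "flip x X \<in> ?V" "flip y (\<phi> X) \<in> ?V" using X flip_copy_in_verts x y by blast+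
        then show "\<bar>f (flip x X) - f (flip y (\<phi> X))\<bar> \<le> L" using L adj[OF X] unfolding lipschitz_def by blast
      qed
      also have "\<dots> = (real ?d - 1) * L"
        using copy finite_generator_copies pos unfolding IntGr_degree_eq[OF x] by (simp add: of_nat_diff)
      finally have R: "\<bar>R\<bar> \<le> (real ?d - 1) * L" .
      have fxy: "\<bar>f x - f y\<bar> \<le> L" using L x y \<open>IntGr_adj \<Phi> x y\<close> unfolding lipschitz_def by blast
      have d1: "1 \<le> real ?d" using pos by simp
      \<comment> \<open>The lazy half contributes \<open>d\<close> times \<open>f x - f y\<close>,
        and the exchange of \<open>x\<close> and \<open>y\<close> takes one of these away. So both
        summands are at most \<open>(d - 1) * L\<close>, to be divided by
        \<open>2 * d\<close>.\<close>
      have "2 * real ?d * (step_fun f x - step_fun f y) = (real ?d - 1) * (f x - f y) + R"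
        unfolding step[OF x] step[OF y] sx sy R_def sum_subtractf using pos by (simp add: field_simps)
      also have "\<bar>\<dots>\<bar> \<le> (real ?d - 1) * L + (real ?d - 1) * L"
      proof -
        have "\<bar>(real ?d - 1) * (f x - f y)\<bar> \<le> (real ?d - 1) * L"
          using fxy d1 by (simp add: abs_mult mult_left_mono)
        then show ?thesis using R by linarith
      qed
      finally have "2 * real ?d * \<bar>step_fun f x - step_fun f y\<bar> \<le> 2 * ((real ?d - 1) * L)"
        using d1 by (simp add: abs_mult mult.commute)
      then show "\<bar>step_fun f x - step_fun f y\<bar> \<le> (1 - 1 / real ?d) * L"
        using pos by (simp add: field_simps)
    qed
  qed
qed

text \<open>Without copies every function is Lipschitz with constant \<open>0\<close>. Applied to
  the indicator of \<open>w\<close>, this shows that \<open>w\<close> is the only vertex, so the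
  walk starts in equilibrium.\<close>

lemma IntGr_tmix_degree_zero:
  assumes w: "w \<in> IntGr_verts \<Phi> s" and zero: "IntGr_degree \<Phi> s = 0"
  shows "IntGr_tmix \<Phi> s = 0"
proof -
  let ?V = "IntGr_verts \<Phi> s" and ?P = "lazy_step (IntGr_verts \<Phi> s) (IntGr_adj \<Phi>)"
  have no: "\<not> generator_copy \<Phi> x X" if "x \<in> ?V" for x X
    using IntGr_degree_eq[OF that] zero finite_generator_copies[of \<Phi> x] by auto
  have "x = w" if "x \<in> ?V" for x
  proof -
    have "\<bar>of_bool (x = w) - of_bool (w = w)\<bar> \<le> (0::real) * real (card (diff_games x w))"
      using no by (intro lipschitz_diff_games[OF _ that w]) (auto simp: IntGr_adj_def)
    then show ?thesis by (cases "x = w") auto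
  qed
  then have V: "?V = {w}" using w by blast
  have Pw: "?P w = return_pmf w"
    using nbrs_IntGr[OF w] no[OF w] by (simp add: lazy_step_def)
  have "stationary ?V ?P = return_pmf w"
    unfolding stationary_def
  proof (rule the_equality)
    show "set_pmf (return_pmf w) \<subseteq> ?V \<and> bind_pmf (return_pmf w) ?P = return_pmf w"
      using w Pw by (simp add: bind_return_pmf)
  next
    fix \<pi> assume "set_pmf \<pi> \<subseteq> ?V \<and> bind_pmf \<pi> ?P = \<pi>"
    then show "\<pi> = return_pmf w" unfolding V by (simp add: set_pmf_subset_singleton)
  qed
  then have "mixing_distance ?V ?P 0 \<le> 1 / 4"
    unfolding mixing_distance_def V by simp
  then have "IntGr_tmix \<Phi> s \<le> enat 0" unfolding IntGr_tmix_def by (rule mixing_time_le)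
  then show ?thesis by (simp add: zero_enat_def[symmetric])
qed

text \<open>Every generator involves two distinct indices. Hence positive degree gives rank at least
  2, which keeps the logarithm away from 0.\<close>

lemma IntGr_degree_rank_one:
  assumes "w \<in> IntGr_verts \<Phi> s" "cox_rank \<Phi> \<le> 1"
  shows "IntGr_degree \<Phi> s = 0"
proof -
  have "\<not> generator_games \<Phi> X" for X
    using assms(2) by (auto elim!: generator_games.cases)
  then show ?thesis unfolding IntGr_degree_eq[OF assms(1)] generator_copy_def by simp
qed

text \<open>\<open>t\<close> is chosen so that \<open>exp (- t / d)\<close> is at most
  \<open>1 / (4 * n ^ 2)\<close>; the diameter bound \<open>n ^ 2\<close> then cancels and leaves
  1/4.\<close>

lemma mixing_steps_bound:
  fixes d n :: nat
  assumes "0 < d" "2 \<le> n"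
  defines "t \<equiv> nat \<lceil>real d * ln (4 * real n ^ 2)\<rceil>"
  shows "(1 - 1 / real d) ^ t * real n ^ 2 \<le> 1 / 4" "real t \<le> 6 * real d * ln (real n)"
proof -
  have ln2: "1 / 2 \<le> ln (2::real)" using ln2_ge_two_thirds by simp
  have lnn: "ln 2 \<le> ln (real n)" using assms(2) by simp
  have n: "0 < real n" using assms(2) by simp
  have ln4: "ln (4 * real n ^ 2) = 2 * ln 2 + 2 * ln (real n)"
  proof -
    have *: "4 * real n ^ 2 = (2 * real n) ^ 2" by (simp add: power2_eq_square)
    have "ln (4 * real n ^ 2) = 2 * ln (2 * real n)"
      unfolding * using n by (subst ln_realpow) simp_all
    then show ?thesis using n by (simp add: ln_mult)
  qed
  have t0: "0 \<le> real d * ln (4 * real n ^ 2)" unfolding ln4 using ln2 lnn by simp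
  have t1: "real d * ln (4 * real n ^ 2) \<le> real t" unfolding t_def by (rule real_nat_ceiling_ge)
  have "1 - 1 / real d \<le> exp (- (1 / real d))" using exp_ge_add_one_self[of "- (1 / real d)"] by simp
  then have "(1 - 1 / real d) ^ t \<le> exp (- (1 / real d)) ^ t"
    using assms(1) by (intro power_mono) (auto simp: field_simps)
  also have "\<dots> = exp (- (real t / real d))" by (simp add: exp_of_nat_mult[symmetric])
  also have "\<dots> \<le> exp (- ln (4 * real n ^ 2))"
    using t1 assms(1) by (simp add: field_simps)
  also have "\<dots> = 1 / (4 * real n ^ 2)" using n by (simp add: exp_minus field_simps)
  finally have "(1 - 1 / real d) ^ t * real n ^ 2 \<le> 1 / (4 * real n ^ 2) * real n ^ 2"
    by (intro mult_right_mono) auto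
  then show "(1 - 1 / real d) ^ t * real n ^ 2 \<le> 1 / 4" using n by simp
  have "real t \<le> real d * ln (4 * real n ^ 2) + 1"
    unfolding t_def using t0 by linarith
  \<comment> \<open>As \<open>n\<close> is at least 2, \<open>2 * ln 2\<close> is at most
    \<open>2 * ln n\<close>, which accounts for the 4. Rounding costs at most 1, which is at most
    \<open>2 * d * ln n\<close> because \<open>ln 2\<close> is at least 1/2. Together they give the
    constant 6.\<close>
  also have "\<dots> \<le> real d * (4 * ln (real n)) + real d * (2 * ln (real n))"
  proof (rule add_mono)
    show "real d * ln (4 * real n ^ 2) \<le> real d * (4 * ln (real n))"
      unfolding ln4 using lnn by (intro mult_left_mono) auto
    have "1 \<le> real d * 1" using assms(1) by simp
    also have "\<dots> \<le> real d * (2 * ln (real n))" using ln2 lnn by (intro mult_left_mono) auto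
    finally show "1 \<le> real d * (2 * ln (real n))" .
  qed
  finally show "real t \<le> 6 * real d * ln (real n)" by (simp add: algebra_simps)
qed

lemma IntGr_tmix_le:
  assumes w: "w \<in> IntGr_verts \<Phi> s"
  shows "ereal_of_enat (IntGr_tmix \<Phi> s) \<le> ereal (6 * real (IntGr_degree \<Phi> s) * ln (real (cox_rank \<Phi>)))"
proof (cases "IntGr_degree \<Phi> s = 0")
  \<comment> \<open>The right-hand side is \<open>0\<close> here, so the mixing time has to be
    exactly \<open>0\<close>.\<close>
  case True
  then show ?thesis using IntGr_tmix_degree_zero[OF w] by simp
next
  case False
  then have n: "2 \<le> cox_rank \<Phi>" using IntGr_degree_rank_one[OF w] by fastforce
  interpret contracting_lazy_walk "IntGr_verts \<Phi> s" "IntGr_adj \<Phi>" "IntGr_degree \<Phi> s" "real (cox_rank \<Phi>) ^ 2"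
    using False w by (intro IntGr_contracting) auto
  define t where "t = nat \<lceil>real (IntGr_degree \<Phi> s) * ln (4 * real (cox_rank \<Phi>) ^ 2)\<rceil>"
  note t = mixing_steps_bound[OF d_pos n, folded t_def]
  have "IntGr_tmix \<Phi> s \<le> enat t"
    unfolding IntGr_tmix_def using mixing_distance_le[of t] t(1) by (intro mixing_time_le) linarith
  then have "ereal_of_enat (IntGr_tmix \<Phi> s) \<le> ereal (real t)"
    by (metis ereal_of_enat_le_iff ereal_of_enat_simps(1))
  also have "\<dots> \<le> ereal (6 * real (IntGr_degree \<Phi> s) * ln (real (cox_rank \<Phi>)))" using t(2) by simp
  finally show ?thesis .
qed

theorem theorem24:
  shows "\<exists>C::real. C > 0 \<and>
    (\<forall>n::nat. n \<ge> 1 \<longrightarrow>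
      (\<forall>\<Phi> \<in> {Type_B n, Type_D n}. \<forall>s \<in> Score \<Phi>.
        ereal_of_enat (IntGr_tmix \<Phi> s)
          \<le> ereal (C * real (IntGr_degree \<Phi> s) * ln (real n))))"
proof (intro exI[of _ 6] conjI allI impI ballI)
  fix n :: nat and \<Phi> s
  assume \<Phi>: "\<Phi> \<in> {Type_B n, Type_D n}" and "s \<in> Score \<Phi>"
  then obtain w where "w \<in> IntGr_verts \<Phi> s" unfolding Score_def IntGr_verts_def by blast
  moreover have "cox_rank \<Phi> = n" using \<Phi> by auto
  ultimately show "ereal_of_enat (IntGr_tmix \<Phi> s) \<le> ereal (6 * real (IntGr_degree \<Phi> s) * ln (real n))"
    using IntGr_tmix_le by blast
qed simp

end
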